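(* Let $f:\mathbb R\to\mathbb R$ be a continuous $2\pi$-periodic function with $f\in H^1$ (that is, $\|f\|_2+\|f'\|_2<+\infty$), $\langle f,f\rangle>0$, $\langle f',f'\rangle>0$, and $\int_0^{2\pi}f(x)\,dx=0$. Let $(a_k)_{k\ge1}$ be i.i.d. real random variables on a probability space $(\Omega,\mathcal F,\mathbb P)$, centered, with variance one and with a finite third moment, and let $X$ be uniformly distributed on $[0,2\pi]$ and independent of $(a_k)_{k\ge 1}$. Set $f_n(t)=\frac{1}{\sqrt n}\sum_{k=1}^n a_k f(kt)$. Then, $\mathbb P$-almost surely, for all $t\in\mathbb R$, $$\lim_{n\to+\infty}\mathbb E_X\left[e^{itf_n(X)}\right]=e^{-\frac{t^2}{2}\langle f,f\rangle}.$$ In other words, $\mathbb P$-almost surely, the sequence of random variables $(f_n(X))_n$ converges in distribution under $\mathbb P_X$ to a centered Gaussian variable with variance $\langle f,f\rangle$.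
   Context: Here $\langle u,v\rangle=\frac1{2\pi}\int_0^{2\pi}u(x)v(x)\,dx$ and $\|u\|_2^2=\langle u,u\rangle$. The underlying space is the product $(\Omega\times[0,2\pi],\mathcal F\otimes\mathcal B([0,2\pi]),\mathbb P\otimes\mathbb P_X)$, where $\mathbb P_X$ is the uniform distribution on $[0,2\pi]$, $X$ is the second projection and the $a_k$ depend only on the first coordinate; $\mathbb E_X$ denotes expectation with respect to $\mathbb P_X$ only (the coefficients $(a_k)$ being frozen). *)

theory Defs
  imports "HOL-Probability.Probability"
begin

definition inner2pi :: "(real \<Rightarrow> real) \<Rightarrow> (real \<Rightarrow> real) \<Rightarrow> real" where
  "inner2pi u v = (1 / (2 * pi)) * (LBINT x:{0..2*pi}. u x * v x)"

definition square_integrable2pi :: "(real \<Rightarrow> real) \<Rightarrow> bool" where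
  "square_integrable2pi u \<longleftrightarrow>
     set_borel_measurable lborel {0..2*pi} u \<and>
     set_integrable lborel {0..2*pi} (\<lambda>x. (u x)\<^sup>2)"

definition periodic2pi :: "(real \<Rightarrow> real) \<Rightarrow> bool" where
  "periodic2pi u \<longleftrightarrow> (\<forall>x. u (x + 2 * pi) = u x)"

definition smooth :: "(real \<Rightarrow> real) \<Rightarrow> bool" where
  "smooth u \<longleftrightarrow> (\<forall>k x. ((deriv ^^ k) u) field_differentiable (at x))"

text \<open>The weak derivative on the circle: the test functions are smooth and periodic, so integration
  by parts over a period leaves no boundary term.  Only the values of \<open>u\<close> and \<open>u'\<close> on a period
  matter, and \<open>u'\<close> is determined up to a null set.\<close>

definition has_weak_derivative2pi :: "(real \<Rightarrow> real) \<Rightarrow> (real \<Rightarrow> real) \<Rightarrow> bool" where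
  "has_weak_derivative2pi u u' \<longleftrightarrow>
     (\<forall>\<phi>. smooth \<phi> \<and> periodic2pi \<phi> \<longrightarrow> inner2pi u (deriv \<phi>) = - inner2pi u' \<phi>)"

text \<open>Since the Bochner integral is zero on non-integrable functions, membership in
  \<open>L\<^sup>2\<close> is required explicitly, for \<open>u\<close> and for \<open>u'\<close>.\<close>

definition H1_with_derivative :: "(real \<Rightarrow> real) \<Rightarrow> (real \<Rightarrow> real) \<Rightarrow> bool" where
  "H1_with_derivative u u' \<longleftrightarrow>
     square_integrable2pi u \<and> square_integrable2pi u' \<and> has_weak_derivative2pi u u'"

definition P_X :: "real measure" where
  "P_X = uniform_measure lborel {0..2*pi}"

text \<open>Random variables on the product space are functions of a pair (outcome, point); the random
  point \<open>X\<close> is \<^const>\<open>snd\<close>.  \<open>E_X\<close> integrates out the second coordinate with the first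
  one frozen, so that its value is a random variable on the first factor.\<close>

definition E_X :: "('w \<times> real \<Rightarrow> complex) \<Rightarrow> 'w \<Rightarrow> complex" where
  "E_X Z \<omega> = (\<integral>x. Z (\<omega>, x) \<partial>P_X)"

definition random_sum ::
    "(real \<Rightarrow> real) \<Rightarrow> (nat \<Rightarrow> 'w \<Rightarrow> real) \<Rightarrow> nat \<Rightarrow> 'w \<Rightarrow> real \<Rightarrow> real" where
  "random_sum f a n \<omega> t = (1 / sqrt (real n)) * (\<Sum>k=1..n. a k \<omega> * f (real k * t))"

end

theory Submission
  imports Defs "HOL-Real_Asymp.Real_Asymp"
begin

text \<open>A continuous periodic \<open>f\<close> with square integrable weak derivative has an absolutely convergent
  Fourier series (Bessel's inequality for \<open>f'\<close> and Cauchy--Schwarz).  For one frequency \<open>m \<noteq> 0\<close> the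
  functions \<open>x \<mapsto> exp (i m k x)\<close>, \<open>k \<ge> 1\<close>, are orthonormal, so summing over \<open>m\<close> with \<open>A = (\<Sum>m. |c m|)\<close>
  gives \<open>\<parallel>\<Sum>k. b k f(k \<cdot>)\<parallel> \<le> A (\<Sum>k. (b k)\<^sup>2)\<^bsup>1/2\<^esup>\<close>.  The same argument for \<open>f\<^sup>2\<close> shows that
  \<open>(1/n) (\<Sum>k\<le>n. f(k x)\<^sup>2)\<close> and \<open>(1/n) (\<Sum>k\<le>n. f(k x) f(k y))\<close> are within \<open>O(n\<^bsup>-1/2\<^esup>)\<close> of their means in \<open>L\<^sup>2\<close>.

  Averaging over the coefficients first, with two independent copies of \<open>X\<close>, the third moment then
  yields \<open>E |E\<^sub>X exp (i t f\<^sub>n(X)) - exp (- t\<^sup>2 \<langle>f,f\<rangle> / 2)|\<^sup>2 = O(n\<^bsup>-1/2\<^esup>)\<close>, uniformly for bounded \<open>t\<close>.  This is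
  summable along \<open>n = j\<^sup>8\<close> even after summing over a net of \<open>O(j\<^sup>2)\<close> points \<open>t\<close>, whence almost sure
  convergence along this subsequence for all \<open>t\<close> at once.  The norm bound above, applied to the coefficients in
  \<open>(j\<^sup>8, (j+1)\<^sup>8]\<close>, fills the gaps between consecutive terms of the subsequence.\<close>

section \<open>Integration over a period\<close>

text \<open>The mean square estimate holds for one t at a time, while the exceptional null set must
  serve all t. With a fixed dense set of t, passing to the other t would call for an almost sure
  bound on (1/n) sum a_k^2, which controls the Lipschitz constant in t. A net of spacing 1/j^2 at n
  = j^8 makes the crude estimate o(j^2) for that average sufficient. This is also the origin of the
  exponent 8: the rate n^(-1/2) becomes j^(-4), and O(j^2) net points leave a summable j^(-2). Two
  copies of X enter because |E_X Z|^2 is the double integral of Z(x) times the conjugate of Z(y),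
  inside which the coefficients can be averaged. For frozen x and y the exponent is a sum of
  independent terms with weights f(kx) - f(ky). Their mean square is close to 2<f,f> since the
  correlation of f(kx) and f(ky) averages out, and this produces exactly the square of the Gaussian
  factor, so that the variance over the coefficients tends to 0.\<close>

lemma prob_space_P_X: "prob_space P_X"
  unfolding P_X_def by (rule prob_space_uniform_measure) auto

lemma sets_P_X [simp, measurable_cong]: "sets P_X = sets borel"
  by (simp add: P_X_def)

lemma space_P_X [simp]: "space P_X = UNIV"
  by (simp add: P_X_def)

interpretation PX: prob_space P_X
  by (rule prob_space_P_X)

lemma P_X_eq_density: "P_X = density lborel (\<lambda>x. ennreal (indicator {0..2*pi} x / (2 * pi)))"
proof -
  have "ennreal (indicator {0..2*pi} x / (2 * pi)) = indicator {0..2*pi} x / emeasure lborel {0..2*pi}" for x :: real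
    by (auto simp: indicator_def divide_ennreal[symmetric] simp flip: ennreal_numeral)
  then show ?thesis
    by (simp add: P_X_def uniform_measure_def)
qed

lemma
  fixes g :: "real \<Rightarrow> 'a::{banach, second_countable_topology}"
  assumes [measurable]: "g \<in> borel_measurable borel"
  shows integral_P_X: "(\<integral>x. g x \<partial>P_X) = (1 / (2*pi)) *\<^sub>R (LBINT x:{0..2*pi}. g x)"
    and integrable_P_X: "integrable P_X g \<longleftrightarrow> set_integrable lborel {0..2*pi} g"
proof -
  have "(\<integral>x. g x \<partial>P_X) = (\<integral>x. (indicator {0..2*pi} x / (2 * pi)) *\<^sub>R g x \<partial>lborel)"
    unfolding P_X_eq_density by (rule integral_density) auto
  also have "\<dots> = (\<integral>x. (1 / (2*pi)) *\<^sub>R (indicator {0..2*pi} x *\<^sub>R g x) \<partial>lborel)"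
    by (intro Bochner_Integration.integral_cong) (auto simp: indicator_def)
  finally show "(\<integral>x. g x \<partial>P_X) = (1 / (2*pi)) *\<^sub>R (LBINT x:{0..2*pi}. g x)"
    by (simp only: set_lebesgue_integral_def integral_scaleR_right)
  let ?g = "\<lambda>x. indicator {0..2*pi} x *\<^sub>R g x"
  have "integrable P_X g \<longleftrightarrow> integrable lborel (\<lambda>x. (indicator {0..2*pi} x / (2 * pi)) *\<^sub>R g x)"
    unfolding P_X_eq_density by (rule integrable_density) auto
  also have "\<dots> \<longleftrightarrow> integrable lborel (\<lambda>x. (1 / (2*pi)) *\<^sub>R ?g x)"
    by (intro arg_cong2[where f = integrable]) (auto simp: indicator_def)
  also have "\<dots> \<longleftrightarrow> integrable lborel ?g"
    using integrable_scaleR_right[of "2*pi" lborel "\<lambda>x. (1 / (2*pi)) *\<^sub>R ?g x"]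
      integrable_scaleR_right[of "1 / (2*pi)" lborel ?g] by auto
  finally show "integrable P_X g \<longleftrightarrow> set_integrable lborel {0..2*pi} g"
    by (simp add: set_integrable_def)
qed

lemma inner2pi_eq:
  assumes "u \<in> borel_measurable borel" "v \<in> borel_measurable borel"
  shows "inner2pi u v = (\<integral>x. u x * v x \<partial>P_X)"
  using assms by (subst integral_P_X) (auto simp: inner2pi_def)

lemma integrable_P_X_bounded:
  fixes g :: "real \<Rightarrow> 'a::{banach, second_countable_topology}"
  assumes "g \<in> borel_measurable borel" "\<And>x. norm (g x) \<le> B"
  shows "integrable P_X g"
  using assms by (intro PX.integrable_const_bound[of _ B]) auto

lemma measurable_cis [measurable]: "cis \<in> borel_measurable borel"
  by (intro borel_measurable_continuous_onI continuous_intros)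

lemma integral_cis:
  "(\<integral>x. cis (of_int m * x) \<partial>P_X) = (if m = 0 then 1 else 0)"
proof (cases "m = 0")
  case False
  have "(LBINT x:{0..2*pi}. cis (of_int m * x)) =
      - \<i> * cis (of_int m * (2*pi)) / of_int m - (- \<i> * cis (of_int m * 0) / of_int m)"
    unfolding set_lebesgue_integral_def
  proof (rule integral_FTC_atLeastAtMost)
    fix x :: real
    have "((\<lambda>x. - \<i> * cis (of_int m * x) / of_int m) has_vector_derivative
        - \<i> * ((of_int m) *\<^sub>R (\<i> * cis (of_int m * x))) / of_int m) (at x within {0..2*pi})"
      unfolding cis.code
      by (auto intro!: derivative_eq_intros simp: has_vector_derivative_complex_iff field_simps False)
    then show "((\<lambda>x. - \<i> * cis (of_int m * x) / of_int m) has_vector_derivative cis (of_int m * x))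
        (at x within {0..2*pi})"
      using False by (simp add: scaleR_conv_of_real)
  qed (auto intro!: continuous_intros)
  also have "cis (of_int m * (2*pi)) = 1"
    by (metis Ints_of_int cis_multiple_2pi mult.commute)
  finally show ?thesis
    using False by (simp add: integral_P_X)
qed (simp add: PX.prob_space[simplified])

lemma measurable_cis_comp [measurable]:
  "g \<in> borel_measurable M \<Longrightarrow> (\<lambda>x. cis (g x)) \<in> borel_measurable M"
  by measurable

text \<open>Frequencies are given by an injection \<open>\<nu>\<close> rather than by the index
  itself, so that the lemma applies to the frequencies m * k with m fixed and k varying.\<close>

lemma parseval_trig_poly:
  fixes b :: "'i \<Rightarrow> complex" and \<nu> :: "'i \<Rightarrow> int"
  assumes "inj_on \<nu> I"
  shows "(\<integral>x. (cmod (\<Sum>i\<in>I. b i * cis (of_int (\<nu> i) * x)))\<^sup>2 \<partial>P_X) = (\<Sum>i\<in>I. (cmod (b i))\<^sup>2)"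
proof -
  have *: "complex_of_real ((cmod (\<Sum>i\<in>I. b i * cis (of_int (\<nu> i) * x)))\<^sup>2) =
      (\<Sum>i\<in>I. \<Sum>j\<in>I. b i * cnj (b j) * cis (of_int (\<nu> i - \<nu> j) * x))" for x :: real
    by (simp only: complex_norm_square cnj_sum sum_product)
       (intro sum.cong refl, simp add: cis_cnj cis_mult algebra_simps flip: cis_divide)
  have int: "integrable P_X (\<lambda>x. c * cis (of_int m * x))" for c and m :: int
    by (rule integrable_P_X_bounded[of _ "cmod c"]) (auto simp: norm_mult)
  have "complex_of_real (\<integral>x. (cmod (\<Sum>i\<in>I. b i * cis (of_int (\<nu> i) * x)))\<^sup>2 \<partial>P_X) =
      (\<integral>x. (\<Sum>i\<in>I. \<Sum>j\<in>I. b i * cnj (b j) * cis (of_int (\<nu> i - \<nu> j) * x)) \<partial>P_X)"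
    unfolding integral_complex_of_real[symmetric]
    by (rule Bochner_Integration.integral_cong[OF refl]) (rule *)
  also have "\<dots> = (\<Sum>i\<in>I. \<Sum>j\<in>I. b i * cnj (b j) * (if \<nu> i - \<nu> j = 0 then 1 else 0))"
    by (subst Bochner_Integration.integral_sum, intro Bochner_Integration.integrable_sum int)
       (intro sum.cong refl, subst Bochner_Integration.integral_sum, auto simp: integral_cis int simp del: of_int_diff)
  also have "\<dots> = (\<Sum>i\<in>I. \<Sum>j\<in>I. if i = j then b i * cnj (b j) else 0)"
    using assms by (intro sum.cong refl) (auto dest: inj_onD)
  also have "\<dots> = (\<Sum>i\<in>I. b i * cnj (b i))"
    by (cases "finite I") auto
  also have "\<dots> = complex_of_real (\<Sum>i\<in>I. (cmod (b i))\<^sup>2)"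
    by (simp only: of_real_sum complex_norm_square)
  finally show ?thesis
    unfolding of_real_eq_iff .
qed

text \<open>Cauchy-Schwarz after splitting each weight as a product of two square roots. It plays
  the part of Minkowski's inequality in squared form.\<close>

lemma norm_sum_scaled_square_le:
  fixes w z :: "'i \<Rightarrow> complex"
  shows "(cmod (\<Sum>j\<in>J. w j * z j))\<^sup>2 \<le> (\<Sum>j\<in>J. cmod (w j)) * (\<Sum>j\<in>J. cmod (w j) * (cmod (z j))\<^sup>2)"
proof -
  have "cmod (\<Sum>j\<in>J. w j * z j) \<le> (\<Sum>j\<in>J. sqrt (cmod (w j)) * (sqrt (cmod (w j)) * cmod (z j)))"
    by (rule order.trans[OF norm_sum]) (simp add: norm_mult flip: mult.assoc)
  then have "(cmod (\<Sum>j\<in>J. w j * z j))\<^sup>2 \<le> (\<Sum>j\<in>J. sqrt (cmod (w j)) * (sqrt (cmod (w j)) * cmod (z j)))\<^sup>2"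
    by (intro power_mono) auto
  also have "\<dots> \<le> (\<Sum>j\<in>J. (sqrt (cmod (w j)))\<^sup>2) * (\<Sum>j\<in>J. (sqrt (cmod (w j)) * cmod (z j))\<^sup>2)"
    by (rule Cauchy_Schwarz_ineq_sum)
  finally show ?thesis
    by (simp add: power_mult_distrib)
qed

text \<open>After exchanging the sums, each fixed j contributes a polynomial in x with frequencies
  \<open>r j * k\<close>. These are distinct in k because \<open>r j\<close> is nonzero, so Parseval
  gives it the same squared norm for every j. Injectivity of \<open>r\<close> is not asked for: for
  the square of f the index j is a pair of frequencies and \<open>r\<close> their sum.\<close>

lemma dilated_trig_poly_bound:
  fixes b :: "nat \<Rightarrow> complex" and w :: "'j \<Rightarrow> complex" and r :: "'j \<Rightarrow> int"
  assumes "\<And>j. j \<in> J \<Longrightarrow> r j \<noteq> 0"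
  shows "(\<integral>x. (cmod (\<Sum>k\<in>I. b k * (\<Sum>j\<in>J. w j * cis (of_int (r j) * (of_nat k * x)))))\<^sup>2 \<partial>P_X)
    \<le> (\<Sum>j\<in>J. cmod (w j))\<^sup>2 * (\<Sum>k\<in>I. (cmod (b k))\<^sup>2)"
proof -
  define h where "h j x = (\<Sum>k\<in>I. b k * cis (of_int (r j * int k) * x))" for j x
  have [measurable]: "h j \<in> borel_measurable borel" for j
    unfolding h_def by measurable
  have h_bound: "cmod (h j x) \<le> (\<Sum>k\<in>I. cmod (b k))" for j x
    unfolding h_def by (rule order.trans[OF norm_sum]) (simp add: norm_mult)
  have int: "integrable P_X (\<lambda>x. (cmod (h j x))\<^sup>2)" for j
    using h_bound by (intro integrable_P_X_bounded[where B = "(\<Sum>k\<in>I. cmod (b k))\<^sup>2"]) (auto intro!: power_mono)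
  have eq: "(\<Sum>k\<in>I. b k * (\<Sum>j\<in>J. w j * cis (of_int (r j) * (of_nat k * x)))) = (\<Sum>j\<in>J. w j * h j x)" for x
    unfolding h_def sum_distrib_left by (subst sum.swap) (simp add: mult_ac)
  have bound: "cmod (\<Sum>j\<in>J. w j * h j x) \<le> (\<Sum>j\<in>J. cmod (w j) * (\<Sum>k\<in>I. cmod (b k)))" for x
    by (rule order.trans[OF norm_sum]) (intro sum_mono, simp add: norm_mult h_bound mult_left_mono)
  have "(\<integral>x. (cmod (\<Sum>j\<in>J. w j * h j x))\<^sup>2 \<partial>P_X)
      \<le> (\<integral>x. (\<Sum>j\<in>J. cmod (w j)) * (\<Sum>j\<in>J. cmod (w j) * (cmod (h j x))\<^sup>2) \<partial>P_X)"
  proof (rule integral_mono)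
    show "integrable P_X (\<lambda>x. (cmod (\<Sum>j\<in>J. w j * h j x))\<^sup>2)"
      using bound by (intro integrable_P_X_bounded[where B = "(\<Sum>j\<in>J. cmod (w j) * (\<Sum>k\<in>I. cmod (b k)))\<^sup>2"])
        (auto intro!: power_mono)
  qed (auto intro!: norm_sum_scaled_square_le int)
  also have "\<dots> = (\<Sum>j\<in>J. cmod (w j)) * (\<Sum>j\<in>J. cmod (w j) * (\<integral>x. (cmod (h j x))\<^sup>2 \<partial>P_X))"
    by (simp add: int)
  also have "(\<Sum>j\<in>J. cmod (w j) * (\<integral>x. (cmod (h j x))\<^sup>2 \<partial>P_X)) = (\<Sum>j\<in>J. cmod (w j) * (\<Sum>k\<in>I. (cmod (b k))\<^sup>2))"
    unfolding h_def using assms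
    by (intro sum.cong refl arg_cong2[where f = "(*)"] parseval_trig_poly) (auto simp: inj_on_def)
  finally show ?thesis
    by (simp only: eq) (simp add: power2_eq_square mult.assoc flip: sum_distrib_right)
qed

section \<open>Fourier series of continuous functions with square integrable weak derivative\<close>

lemma integrable_P_X_continuous:
  fixes g :: "real \<Rightarrow> 'a::{banach, second_countable_topology}"
  assumes "continuous_on UNIV g"
  shows "integrable P_X g"
  using assms borel_integrable_atLeastAtMost'[of 0 "2*pi" g]
  by (subst integrable_P_X) (auto intro: borel_measurable_continuous_onI continuous_on_subset)

section \<open>Uniqueness of Fourier coefficients via Stone-Weierstrass on the circle\<close>

lemma periodic_Arg2pi_cis:
  assumes "\<And>x. u (x + 2 * pi) = u x"
  shows "u (Arg2pi (cis x)) = u x"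
proof -
  interpret periodic_fun_simple u "2 * pi"
    by unfold_locales (rule assms)
  have "cis (Arg2pi (cis x)) = cis x"
    using Arg2pi_eq[of "cis x"] by (simp add: cis_conv_exp)
  then have "sin x = sin (Arg2pi (cis x)) \<and> cos x = cos (Arg2pi (cis x))"
    by (auto simp: complex_eq_iff)
  then obtain n :: int where "x = Arg2pi (cis x) + of_int n * (2 * pi)"
    unfolding sin_cos_eq_iff by (auto simp: mult_ac)
  then show ?thesis
    by (metis plus_of_int)
qed

text \<open>\<open>Arg2pi\<close> jumps at 1, and periodicity of u repairs the jump. The continuity
  is read off from the correspondence between homotopies of loops and of circle maps, applied to the
  constant homotopy of the loop \<open>p\<close>.\<close>

lemma continuous_on_circle_Arg2pi:
  fixes u :: "real \<Rightarrow> 'a::real_normed_vector"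
  assumes "continuous_on UNIV u" "\<And>x. u (x + 2 * pi) = u x"
  shows "continuous_on (sphere 0 1) (\<lambda>z. u (Arg2pi z))"
proof -
  define p where "p s = u (2 * pi * s)" for s
  have "homotopic_loops UNIV p p"
    using assms(2)[of 0] unfolding homotopic_loops_refl p_def path_def pathstart_def pathfinish_def
    by (auto intro!: continuous_on_compose2[OF assms(1)] continuous_intros)
  from homotopic_loops_imp_homotopic_circlemaps[OF this]
  have "continuous_on (sphere 0 1) (p \<circ> (\<lambda>z. Arg2pi z / (2 * pi)))"
    using homotopic_with_imp_continuous by blast
  then show ?thesis
    by (simp add: p_def o_def)
qed

text \<open>Orthogonality to all frequencies is stable under multiplication by polynomials in
  \<open>cis x\<close>: a linear one shifts frequencies by 1 in both directions, so all m are
  treated at once. The function u is generalized because in the product case \<open>u * p\<close>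
  takes its place.\<close>

lemma orthogonal_times_polynomial:
  fixes p :: "complex \<Rightarrow> real" and u :: "real \<Rightarrow> complex"
  assumes "real_polynomial_function p" "continuous_on UNIV u"
    and "\<And>m::int. (\<integral>x. u x * cis (of_int m * x) \<partial>P_X) = 0"
  shows "(\<integral>x. u x * p (cis x) * cis (of_int m * x) \<partial>P_X) = 0"
  using assms
proof (induction arbitrary: u m rule: real_polynomial_function.induct)
  case (linear p)
  note hyps = linear
  interpret bounded_linear p by (rule hyps)
  have p: "p (cis x) = cos x * p 1 + sin x * p \<i>" for x
  proof -
    have "cis x = cos x *\<^sub>R 1 + sin x *\<^sub>R \<i>"
      by (simp add: complex_eq_iff)
    then show ?thesis
      by (simp only: add scaleR) simp
  qed
  \<comment> \<open>Euler's formulas for cos and sin, collected by \<open>cis x\<close> and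
    \<open>cis (- x)\<close>. Here p is only real-linear, so \<open>p 1\<close> and
    \<open>p \<i>\<close> are independent.\<close>
  define \<alpha> \<beta> where "\<alpha> = (p 1 - \<i> * p \<i>) / 2" and "\<beta> = (p 1 + \<i> * p \<i>) / 2"
  have "u x * p (cis x) * cis (of_int m * x) =
      \<alpha> * (u x * cis (of_int (m + 1) * x)) + \<beta> * (u x * cis (of_int (m - 1) * x))" for x
  proof -
    have "complex_of_real (p (cis x)) = \<alpha> * cis x + \<beta> * cis (- x)"
      by (simp add: p \<alpha>_def \<beta>_def complex_eq_iff field_simps)
    moreover have "cis (of_int (m + 1) * x) = cis (of_int m * x) * cis x"
      "cis (of_int (m - 1) * x) = cis (of_int m * x) * cis (- x)"
      by (simp_all add: cis_mult algebra_simps)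
    ultimately show ?thesis
      by (simp add: algebra_simps)
  qed
  moreover have "integrable P_X (\<lambda>x. u x * cis (of_int k * x))" for k
    by (intro integrable_P_X_continuous continuous_intros hyps(2))
  ultimately show ?case
    by (simp only: hyps(3) Bochner_Integration.integral_add integrable_mult_right integral_mult_right_zero) simp
next
  case (const c)
  have "u x * complex_of_real c * cis (of_int m * x) = of_real c * (u x * cis (of_int m * x))" for x
    by simp
  then show ?case
    using const(2) by (simp only: integral_mult_right_zero) simp
next
  case (add p q)
  have *: "continuous_on UNIV (\<lambda>x. r (cis x))" if "real_polynomial_function r" for r :: "complex \<Rightarrow> real"
    using that by (intro continuous_on_compose2[where f = cis and g = r and t = UNIV] continuous_intros)
      (auto intro!: continuous_on_polymonial_function simp: real_polynomial_function_eq)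
  have "(\<integral>x. u x * complex_of_real (p (cis x) + q (cis x)) * cis (of_int m * x) \<partial>P_X) =
      (\<integral>x. u x * p (cis x) * cis (of_int m * x) + u x * q (cis x) * cis (of_int m * x) \<partial>P_X)"
    by (simp add: algebra_simps)
  also have "\<dots> = 0"
    using add by (subst Bochner_Integration.integral_add)
      (auto intro!: integrable_P_X_continuous continuous_intros *)
  finally show ?case .
next
  case (mult p q)
  have *: "continuous_on UNIV (\<lambda>x. p (cis x))"
    using mult(1) by (intro continuous_on_compose2[where f = cis and g = p and t = UNIV] continuous_intros)
      (auto intro!: continuous_on_polymonial_function simp: real_polynomial_function_eq)
  have "(\<integral>x. (u x * p (cis x)) * q (cis x) * cis (of_int m * x) \<partial>P_X) = 0"
    using mult by (intro mult.IH(2)) (auto intro!: continuous_intros *)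
  then show ?case
    by (simp add: mult_ac)
qed

text \<open>A polynomial q in \<open>cis x\<close> approximates u uniformly within e, and h is
  orthogonal to q. Hence only the integral of \<open>h * (u - q)\<close> remains, which is at most e
  times the L1 norm of h, and e tends to 0.\<close>

lemma orthogonal_continuous_periodic:
  fixes h :: "real \<Rightarrow> complex" and u :: "real \<Rightarrow> real"
  assumes h: "continuous_on UNIV h" "\<And>m::int. (\<integral>x. h x * cis (of_int m * x) \<partial>P_X) = 0"
    and u: "continuous_on UNIV u" "\<And>x. u (x + 2 * pi) = u x"
  shows "(\<integral>x. h x * u x \<partial>P_X) = 0"
proof -
  have "cmod (\<integral>x. h x * u x \<partial>P_X) \<le> e * (\<integral>x. cmod (h x) \<partial>P_X)" if "e > 0" for e :: real
  proof -
    obtain q where q: "real_polynomial_function q" "\<And>z. z \<in> sphere 0 1 \<Longrightarrow> \<bar>u (Arg2pi z) - q z\<bar> < e"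
      using Stone_Weierstrass_real_polynomial_function[OF compact_sphere continuous_on_circle_Arg2pi[OF u] \<open>e > 0\<close>]
      by metis
    have [continuous_intros]: "continuous_on UNIV (\<lambda>x. q (cis x))"
      using q(1) by (intro continuous_on_compose2[where f = cis and g = q and t = UNIV] continuous_intros)
        (auto intro!: continuous_on_polymonial_function simp: real_polynomial_function_eq)
    have *: "\<bar>u x - q (cis x)\<bar> \<le> e" for x
      using q(2)[of "cis x"] by (simp add: periodic_Arg2pi_cis[of u, OF u(2)])
    have "(\<integral>x. h x * q (cis x) \<partial>P_X) = 0"
      using orthogonal_times_polynomial[OF q(1) h, of 0] by simp
    then have "(\<integral>x. h x * u x \<partial>P_X) = (\<integral>x. h x * u x \<partial>P_X) - (\<integral>x. h x * q (cis x) \<partial>P_X)"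
      by simp
    also have "\<dots> = (\<integral>x. h x * (u x - q (cis x)) \<partial>P_X)"
      by (subst Bochner_Integration.integral_diff[symmetric])
        (auto intro!: integrable_P_X_continuous continuous_intros h u simp: algebra_simps)
    also have "cmod \<dots> \<le> (\<integral>x. cmod (h x * (u x - q (cis x))) \<partial>P_X)"
      by (rule integral_norm_bound)
    also have "\<dots> \<le> (\<integral>x. e * cmod (h x) \<partial>P_X)"
    proof (rule integral_mono)
      fix x
      have "cmod (h x) * \<bar>u x - q (cis x)\<bar> \<le> cmod (h x) * e"
        by (intro mult_left_mono *) auto
      then show "cmod (h x * (u x - q (cis x))) \<le> e * cmod (h x)"
        by (simp add: norm_mult mult.commute flip: of_real_diff)
    qed (auto intro!: integrable_P_X_continuous continuous_intros h u)
    finally show ?thesis by simp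
  qed
  then have le: "cmod (\<integral>x. h x * u x \<partial>P_X) \<le> e * (\<integral>x. cmod (h x) \<partial>P_X)" if "e > 0" for e
    using that by blast
  have "((\<lambda>e. e * (\<integral>x. cmod (h x) \<partial>P_X)) \<longlongrightarrow> 0 * (\<integral>x. cmod (h x) \<partial>P_X)) (at_right 0)"
    by (intro tendsto_intros)
  then have "cmod (\<integral>x. h x * u x \<partial>P_X) \<le> 0 * (\<integral>x. cmod (h x) \<partial>P_X)"
    by (rule tendsto_lowerbound) (auto simp: eventually_at_right_less le intro!: eventually_mono[OF eventually_at_right_less])
  then show ?thesis by simp
qed

lemma continuous_nonneg_integral_zero:
  fixes g :: "real \<Rightarrow> real"
  assumes "continuous_on UNIV g" "\<And>x. g x \<ge> 0" "(\<integral>x. g x \<partial>P_X) = 0" "0 \<le> x" "x \<le> 2 * pi"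
  shows "g x = 0"
proof -
  have cont: "continuous_on {0..2*pi} g"
    using assms(1) continuous_on_subset by blast
  have "(LBINT x:{0..2*pi}. g x) = integral {0..2*pi} g"
    by (intro set_borel_integral_eq_integral borel_integrable_atLeastAtMost' cont)
  then have "integral {0..2*pi} g = 0"
    using assms(1,3) by (simp add: integral_P_X borel_measurable_continuous_onI)
  then show ?thesis
    using integral_eq_0_iff[of 0 "2*pi" g] cont assms(2,4,5) by auto
qed

text \<open>h is tested against its own real and imaginary parts: the real part of the first
  integral and the imaginary part of the second are the integrals of
  \<open>(Re (h x))\<^sup>2\<close> and \<open>(Im (h x))\<^sup>2\<close>. Continuity turns their
  vanishing into pointwise vanishing on a period.\<close>

lemma fourier_coeffs_zero_imp_zero:
  fixes h :: "real \<Rightarrow> complex"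
  assumes h: "continuous_on UNIV h" "\<And>m::int. (\<integral>x. h x * cis (of_int m * x) \<partial>P_X) = 0"
    and per: "\<And>x. h (x + 2 * pi) = h x"
  shows "h x = 0"
proof -
  have int: "integrable P_X (\<lambda>x. h x * complex_of_real (u x))" if "continuous_on UNIV u" for u :: "real \<Rightarrow> real"
    by (intro integrable_P_X_continuous continuous_intros h that)
  have cont: "continuous_on UNIV (\<lambda>x. Re (h x))" "continuous_on UNIV (\<lambda>x. Im (h x))"
    by (intro continuous_intros h)+
  have 0: "(\<integral>x. h x * Re (h x) \<partial>P_X) = 0" "(\<integral>x. h x * Im (h x) \<partial>P_X) = 0"
    by (intro orthogonal_continuous_periodic h cont; simp add: per)+
  have Re0: "(\<integral>x. (Re (h x))\<^sup>2 \<partial>P_X) = 0"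
    using arg_cong[OF 0(1), of Re] integral_Re[OF int[OF cont(1)]] by (simp add: power2_eq_square)
  have Im0: "(\<integral>x. (Im (h x))\<^sup>2 \<partial>P_X) = 0"
    using arg_cong[OF 0(2), of Im] integral_Im[OF int[OF cont(2)]] by (simp add: power2_eq_square)
  have *: "h y = 0" if "0 \<le> y" "y \<le> 2 * pi" for y
    using continuous_nonneg_integral_zero[OF continuous_on_power[OF cont(1)] _ Re0 that]
      continuous_nonneg_integral_zero[OF continuous_on_power[OF cont(2)] _ Im0 that]
    by (auto simp: complex_eq_iff)
  have "h (Arg2pi (cis x)) = 0"
    by (intro *) (auto simp: Arg2pi_ge_0 intro: less_imp_le[OF Arg2pi_lt_2pi])
  then show ?thesis
    using periodic_Arg2pi_cis[of h, OF per] by simp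
qed

text \<open>The integral of |F - P|^2 is nonnegative, where P is the Fourier polynomial of F on I.
  Continuity of F is not assumed, since F will be a weak derivative.\<close>

lemma bessel_inequality:
  fixes F :: "real \<Rightarrow> real"
  assumes [measurable]: "F \<in> borel_measurable borel" and sq: "integrable P_X (\<lambda>x. (F x)\<^sup>2)"
    and "finite I"
  defines "d \<equiv> \<lambda>m::int. (\<integral>x. F x * cis (- (of_int m * x)) \<partial>P_X)"
  shows "(\<Sum>m\<in>I. (cmod (d m))\<^sup>2) \<le> (\<integral>x. (F x)\<^sup>2 \<partial>P_X)"
proof -
  have F: "integrable P_X F"
    by (rule PX.square_integrable_imp_integrable) (use sq in auto)
  have int: "integrable P_X (\<lambda>x. complex_of_real (F x) * cis (g x))" if [measurable]: "g \<in> borel_measurable borel" for g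
    by (rule Bochner_Integration.integrable_bound[OF F]) (auto simp: norm_mult)
  define P where "P x = (\<Sum>m\<in>I. d m * cis (of_int m * x))" for x
  have [measurable]: "P \<in> borel_measurable borel"
    unfolding P_def by measurable
  have P_bound: "cmod (P x) \<le> (\<Sum>m\<in>I. cmod (d m))" for x
    unfolding P_def by (rule order.trans[OF norm_sum]) (simp add: norm_mult)
  have intP: "integrable P_X (\<lambda>x. (cmod (P x))\<^sup>2)"
    using P_bound by (intro integrable_P_X_bounded[where B = "(\<Sum>m\<in>I. cmod (d m))\<^sup>2"]) (auto intro!: power_mono)
  have intFP: "integrable P_X (\<lambda>x. F x * P x)"
    unfolding P_def sum_distrib_left
    by (intro Bochner_Integration.integrable_sum)
       (use int in \<open>auto simp: mult.left_commute intro!: integrable_mult_right\<close>)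
  have cnj_d: "(\<integral>x. F x * cis (of_int m * x) \<partial>P_X) = cnj (d m)" for m
    unfolding d_def using Bochner_Integration.integral_cnj[of P_X "\<lambda>x. F x * cis (- (of_int m * x))"] by (simp add: cis_cnj)
  have "(\<integral>x. F x * P x \<partial>P_X) = (\<Sum>m\<in>I. d m * cnj (d m))"
    unfolding P_def sum_distrib_left mult.left_commute[of "complex_of_real _"]
    by (subst Bochner_Integration.integral_sum) (use int in \<open>auto simp: cnj_d\<close>)
  also have "\<dots> = complex_of_real (\<Sum>m\<in>I. (cmod (d m))\<^sup>2)"
    by (simp only: of_real_sum complex_norm_square)
  finally have FP: "(\<integral>x. F x * Re (P x) \<partial>P_X) = (\<Sum>m\<in>I. (cmod (d m))\<^sup>2)"
    using integral_Re[OF intFP] by simp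
  have PP: "(\<integral>x. (cmod (P x))\<^sup>2 \<partial>P_X) = (\<Sum>m\<in>I. (cmod (d m))\<^sup>2)"
    unfolding P_def by (rule parseval_trig_poly) auto
  have "integrable P_X (\<lambda>x. F x * Re (P x))"
    using integrable_Re[OF intFP] by simp
  then have "(\<integral>x. (F x)\<^sup>2 - 2 * (F x * Re (P x)) + (cmod (P x))\<^sup>2 \<partial>P_X) =
      (\<integral>x. (F x)\<^sup>2 \<partial>P_X) - (\<Sum>m\<in>I. (cmod (d m))\<^sup>2)"
    using sq intP by (simp add: FP PP)
  moreover have "(F x)\<^sup>2 - 2 * (F x * Re (P x)) + (cmod (P x))\<^sup>2 = (F x - Re (P x))\<^sup>2 + (Im (P x))\<^sup>2" for x
    unfolding cmod_power2 by (simp add: power2_eq_square algebra_simps)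
  then have "(\<integral>x. (F x)\<^sup>2 - 2 * (F x * Re (P x)) + (cmod (P x))\<^sup>2 \<partial>P_X) \<ge> 0"
    by (intro Bochner_Integration.integral_nonneg) simp
  ultimately show ?thesis
    by simp
qed

section \<open>Trigonometric test functions and the Fourier coefficients of a weak
  derivative\<close>

lemma deriv_trig_combination:
  "deriv (\<lambda>x::real. \<alpha> * cos (m * x) + \<beta> * sin (m * x)) =
    (\<lambda>x. (\<beta> * m) * cos (m * x) + (- \<alpha> * m) * sin (m * x))"
  by (rule ext, rule DERIV_imp_deriv) (auto intro!: derivative_eq_intros simp: algebra_simps)

text \<open>The span of cos and sin at one frequency is closed under \<open>deriv\<close>, so every
  iterated derivative stays in it.\<close>

lemma smooth_trig_combination: "smooth (\<lambda>x::real. \<alpha> * cos (m * x) + \<beta> * sin (m * x))"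
proof -
  have "\<exists>\<alpha>' \<beta>'. (deriv ^^ k) (\<lambda>x::real. \<alpha> * cos (m * x) + \<beta> * sin (m * x)) =
      (\<lambda>x. \<alpha>' * cos (m * x) + \<beta>' * sin (m * x))" for k
  proof (induction k)
    case (Suc k)
    then obtain \<alpha>' \<beta>' where "(deriv ^^ k) (\<lambda>x::real. \<alpha> * cos (m * x) + \<beta> * sin (m * x)) =
        (\<lambda>x. \<alpha>' * cos (m * x) + \<beta>' * sin (m * x))"
      by blast
    then have "(deriv ^^ Suc k) (\<lambda>x::real. \<alpha> * cos (m * x) + \<beta> * sin (m * x)) =
        (\<lambda>x. (\<beta>' * m) * cos (m * x) + (- \<alpha>' * m) * sin (m * x))"
      by (simp only: funpow.simps o_apply deriv_trig_combination)
    then show ?case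
      by blast
  qed auto
  moreover have "(\<lambda>x::real. \<alpha>' * cos (m * x) + \<beta>' * sin (m * x)) field_differentiable (at x)" for \<alpha>' \<beta>' x
    unfolding field_differentiable_def by (rule exI) (auto intro!: derivative_eq_intros)
  ultimately show ?thesis
    unfolding smooth_def by metis
qed

lemma periodic_trig_combination:
  "periodic2pi (\<lambda>x. \<alpha> * cos (of_int m * x) + \<beta> * sin (of_int m * x))"
proof -
  have "cis (of_int m * (x + 2 * pi)) = cis (of_int m * x)" for x
    by (simp add: distrib_left flip: cis_mult) (metis Ints_of_int cis_multiple_2pi mult.commute mult_1_right)
  then show ?thesis
    by (auto simp: periodic2pi_def complex_eq_iff)
qed

text \<open>Pairing the frequencies n + 1 and - n - 1 turns two-sided sums into partial sums of a
  series over the naturals, where the summability tests apply.\<close>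

lemma sum_symmetric_int_interval:
  fixes g :: "int \<Rightarrow> 'a::comm_monoid_add"
  shows "(\<Sum>m\<in>{- int N..int N}. g m) = g 0 + (\<Sum>n<N. g (int n + 1) + g (- int n - 1))"
proof (induction N)
  case (Suc N)
  have "{- int (Suc N)..int (Suc N)} = insert (int N + 1) (insert (- int N - 1) {- int N..int N})"
    by auto
  then show ?case
    by (simp add: Suc add_ac)
qed auto

text \<open>What the estimates use of f: symmetric Fourier sums converging pointwise, with absolute
  coefficient sums bounded by A uniformly in N. The condition \<open>c 0 = 0\<close> expresses the
  mean zero, and it excludes the one frequency that dilation does not move.\<close>

locale wiener_algebra =
  fixes f :: "real \<Rightarrow> real" and c :: "int \<Rightarrow> complex" and A :: real
  assumes coeff_sum_le: "(\<Sum>m\<in>{- int N..int N}. cmod (c m)) \<le> A"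
    and fourier_sums: "(\<lambda>N. \<Sum>m\<in>{- int N..int N}. c m * cis (of_int m * x)) \<longlonglongrightarrow> of_real (f x)"
    and coeff_zero: "c 0 = 0"

text \<open>The hypothesis controls f' only on one period, so F cuts it off there to be measurable
  on the whole line. Test functions are real; cos and sin of frequency m as test functions supply
  the real and imaginary parts of the identity.\<close>

lemma fourier_coeff_weak_derivative:
  assumes f: "continuous_on UNIV f" and H1: "H1_with_derivative f f'"
    and F_def: "F = (\<lambda>x. indicator {0..2*pi} x * f' x :: real)"
  shows "F \<in> borel_measurable borel" and "integrable P_X (\<lambda>x. (F x)\<^sup>2)"
    and "(\<integral>x. F x * cis (- (of_int m * x)) \<partial>P_X) = \<i> * of_int m * (\<integral>x. f x * cis (- (of_int m * x)) \<partial>P_X)"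
proof -
  show F[measurable]: "F \<in> borel_measurable borel"
    using H1 unfolding F_def H1_with_derivative_def square_integrable2pi_def set_borel_measurable_def by simp
  have "set_integrable lborel {0..2*pi} (\<lambda>x. (f' x)\<^sup>2)"
    using H1 by (simp add: H1_with_derivative_def square_integrable2pi_def)
  then have "set_integrable lborel {0..2*pi} (\<lambda>x. (F x)\<^sup>2)"
    by (rule set_integrable_cong[THEN iffD1, rotated -1]) (auto simp: F_def)
  then show sq: "integrable P_X (\<lambda>x. (F x)\<^sup>2)"
    by (subst integrable_P_X) auto
  have intF: "integrable P_X F"
    by (rule PX.square_integrable_imp_integrable) (use sq in auto)
  have intf: "integrable P_X f"
    by (rule integrable_P_X_continuous[OF f])
  have f_meas[measurable]: "f \<in> borel_measurable borel"
    by (rule borel_measurable_continuous_onI[OF f])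
  have trig: "(\<integral>x. g x * cis (- (of_int m * x)) \<partial>P_X) =
      Complex (\<integral>x. g x * cos (of_int m * x) \<partial>P_X) (- (\<integral>x. g x * sin (of_int m * x) \<partial>P_X))"
    if g: "integrable P_X g" and [measurable]: "g \<in> borel_measurable borel" for g :: "real \<Rightarrow> real"
  proof -
    have "integrable P_X (\<lambda>x. complex_of_real (g x) * cis (- (of_int m * x)))"
      by (rule Bochner_Integration.integrable_bound[OF g]) (auto simp: norm_mult)
    from integral_Re[OF this] integral_Im[OF this] show ?thesis
      by (simp add: complex_eq_iff)
  qed
  have inner: "inner2pi f' \<phi> = (\<integral>x. F x * \<phi> x \<partial>P_X)" if "\<phi> \<in> borel_measurable borel" for \<phi>
  proof -
    have "inner2pi f' \<phi> = inner2pi F \<phi>"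
      unfolding inner2pi_def set_lebesgue_integral_def F_def
      by (intro arg_cong2[where f = "(*)"] Bochner_Integration.integral_cong refl) (auto simp: indicator_def)
    then show ?thesis
      using inner2pi_eq[OF F that] by simp
  qed
  have weak: "(\<integral>x. f x * (\<beta> * of_int m * cos (of_int m * x) + - \<alpha> * of_int m * sin (of_int m * x)) \<partial>P_X) =
      - (\<integral>x. F x * (\<alpha> * cos (of_int m * x) + \<beta> * sin (of_int m * x)) \<partial>P_X)" for \<alpha> \<beta>
  proof -
    have "inner2pi f (deriv (\<lambda>x. \<alpha> * cos (of_int m * x) + \<beta> * sin (of_int m * x))) =
        - inner2pi f' (\<lambda>x. \<alpha> * cos (of_int m * x) + \<beta> * sin (of_int m * x))"
      using H1 smooth_trig_combination periodic_trig_combination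
      unfolding H1_with_derivative_def has_weak_derivative2pi_def by blast
    then show ?thesis
      by (simp add: inner deriv_trig_combination inner2pi_eq[OF f_meas])
  qed
  show "(\<integral>x. F x * cis (- (of_int m * x)) \<partial>P_X) = \<i> * of_int m * (\<integral>x. f x * cis (- (of_int m * x)) \<partial>P_X)"
    using weak[of 1 0] weak[of 0 1]
    by (simp add: trig intF intf complex_eq_iff mult.left_commute[of _ "of_int m"])
qed

text \<open>Absolute summability makes the Fourier series converge uniformly to a continuous G, but
  not yet to f. As G has the same coefficients as f, the uniqueness result applied to f - G
  identifies the two.\<close>

theorem continuous_H1_wiener_algebra:
  fixes f f' :: "real \<Rightarrow> real"
  assumes f: "continuous_on UNIV f" "periodic2pi f" and H1: "H1_with_derivative f f'"
    and mean: "(LBINT x:{0..2*pi}. f x) = 0"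
  shows "\<exists>c A. wiener_algebra f c A"
proof -
  define F where "F = (\<lambda>x. indicator {0..2*pi} x * f' x :: real)"
  note F = fourier_coeff_weak_derivative[OF f(1) H1 F_def]
  define c where "c m = (\<integral>x. f x * cis (- (of_int m * x)) \<partial>P_X)" for m :: int
  define d where "d m = (\<integral>x. F x * cis (- (of_int m * x)) \<partial>P_X)" for m :: int
  have d_eq: "d m = \<i> * of_int m * c m" for m
    unfolding d_def c_def by (rule F(3))
  have f_meas[measurable]: "f \<in> borel_measurable borel"
    by (rule borel_measurable_continuous_onI[OF f(1)])
  have c0: "c 0 = 0"
    using mean by (simp add: c_def integral_P_X)
  define M where "M n = cmod (c (int n + 1)) + cmod (c (- int n - 1))" for n
  \<comment> \<open>The inequality 2xy <= x^2 + y^2 for the product of |d m| and 1/|m|. Bessel sums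
    the first square, the second is a convergent series.\<close>
  have c_le: "cmod (c m) \<le> (cmod (d m))\<^sup>2 + inverse ((of_int m)\<^sup>2)" if "m \<noteq> 0" for m
  proof -
    have "cmod (c m) = cmod (d m) * inverse \<bar>of_int m\<bar>"
      using that by (simp add: d_eq norm_mult)
    then have "2 * cmod (c m) = 2 * (cmod (d m) * inverse \<bar>of_int m\<bar>)"
      by simp
    also have "2 * (cmod (d m) * inverse \<bar>of_int m\<bar>) \<le> (cmod (d m))\<^sup>2 + (inverse \<bar>of_int m\<bar>)\<^sup>2"
      using sum_squares_bound[of "cmod (d m)" "inverse \<bar>of_int m\<bar>"] by (simp add: mult.assoc)
    finally have "2 * cmod (c m) \<le> (cmod (d m))\<^sup>2 + (inverse \<bar>of_int m\<bar>)\<^sup>2" .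
    then show ?thesis
      using norm_ge_zero[of "c m"] unfolding power_inverse power2_abs by linarith
  qed
  define D where "D n = (cmod (d (int n + 1)))\<^sup>2 + (cmod (d (- int n - 1)))\<^sup>2" for n
  have "(\<Sum>n<N. D n) \<le> (\<integral>x. (F x)\<^sup>2 \<partial>P_X)" for N
    using bessel_inequality[OF F(1,2), of "{- int N..int N}"]
    by (simp add: sum_symmetric_int_interval D_def flip: d_def) (smt (verit) zero_le_power2)
  then have "summable D"
    by (intro summableI_nonneg_bounded) (auto simp: D_def)
  moreover have "summable (\<lambda>n. inverse ((real (Suc n))\<^sup>2))"
    by (subst summable_Suc_iff) (rule inverse_power_summable, simp)
  ultimately have "summable (\<lambda>n. D n + 2 * inverse ((real (Suc n))\<^sup>2))"
    by (intro summable_add summable_mult)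
  moreover have "norm (M n) \<le> D n + 2 * inverse ((real (Suc n))\<^sup>2)" for n
    using c_le[of "int n + 1"] c_le[of "- int n - 1"]
    by (simp add: M_def D_def power2_eq_square algebra_simps)
  ultimately have "summable M"
    by (intro summable_comparison_test[where f = M]) auto
  define S where "S N x = (\<Sum>m\<in>{- int N..int N}. c m * cis (of_int m * x))" for N and x :: real
  have S_eq: "S N x = (\<Sum>n<N. c (int n + 1) * cis (of_int (int n + 1) * x) + c (- int n - 1) * cis (of_int (- int n - 1) * x))" for N x
    unfolding S_def sum_symmetric_int_interval c0 by simp
  have coeff_le: "(\<Sum>m\<in>{- int N..int N}. cmod (c m)) \<le> suminf M" for N
    using sum_le_suminf[OF \<open>summable M\<close>, of "{..<N}"]
    by (auto simp: sum_symmetric_int_interval c0 M_def)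
  have S_bound: "cmod (S N x) \<le> suminf M" for N x
    unfolding S_def by (rule order.trans[OF norm_sum order.trans[OF _ coeff_le]]) (auto simp: norm_mult)
  define G where "G x = (\<Sum>n. c (int n + 1) * cis (of_int (int n + 1) * x) + c (- int n - 1) * cis (of_int (- int n - 1) * x))" for x
  have unif: "uniform_limit UNIV S G sequentially"
    unfolding S_eq G_def 
    by (rule Weierstrass_m_test[OF _ \<open>summable M\<close>])
       (auto simp: M_def norm_mult intro!: order.trans[OF norm_triangle_ineq])
  have S_lim: "(\<lambda>N. S N x) \<longlonglongrightarrow> G x" for x
    using tendsto_uniform_limitI[OF unif] by simp
  have G_cont: "continuous_on UNIV G"
    by (rule uniform_limit_theorem[OF _ unif]) (auto simp: S_def intro!: always_eventually continuous_intros)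
  have S_per: "S N (x + 2 * pi) = S N x" for N x
  proof -
    have "cis (of_int m * (x + 2 * pi)) = cis (of_int m * x)" for m :: int
      using cis_multiple_2pi[of "of_int m"] by (simp add: distrib_left mult_ac flip: cis_mult)
    then show ?thesis by (simp add: S_def)
  qed
  have G_per: "G (x + 2 * pi) = G x" for x
    using S_lim[of x] S_lim[of "x + 2 * pi"] by (simp add: S_per LIMSEQ_unique)
  \<comment> \<open>Integration is against \<open>cis\<close> of +m x, without conjugation, so the
    frequency picked out is - m.\<close>
  have S_coeff: "(\<integral>x. S N x * cis (of_int m * x) \<partial>P_X) = (if \<bar>m\<bar> \<le> int N then c (- m) else 0)" for N m
  proof -
    have "S N x * cis (of_int m * x) = (\<Sum>k\<in>{- int N..int N}. c k * cis (of_int (k + m) * x))" for x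
      unfolding S_def sum_distrib_right by (intro sum.cong refl) (simp add: mult.assoc cis_mult distrib_right)
    then have "(\<integral>x. S N x * cis (of_int m * x) \<partial>P_X) = (\<Sum>k\<in>{- int N..int N}. c k * (if k + m = 0 then 1 else 0))"
      by (simp add: Bochner_Integration.integral_sum integrable_P_X_continuous integral_cis continuous_intros del: of_int_add)
    also have "\<dots> = (\<Sum>k\<in>{- int N..int N}. if k = - m then c k else 0)"
      by (intro sum.cong) auto
    finally show ?thesis by auto
  qed
  have G_coeff: "(\<integral>x. G x * cis (of_int m * x) \<partial>P_X) = c (- m)" for m
  proof (rule LIMSEQ_unique)
    show "(\<lambda>N. \<integral>x. S N x * cis (of_int m * x) \<partial>P_X) \<longlonglongrightarrow> (\<integral>x. G x * cis (of_int m * x) \<partial>P_X)"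
    proof (rule integral_dominated_convergence[where w = "\<lambda>_. suminf M"])
      show "(\<lambda>x. S N x * cis (real_of_int m * x)) \<in> borel_measurable P_X" for N
        unfolding S_def by measurable
      have [measurable]: "G \<in> borel_measurable borel"
        by (rule borel_measurable_continuous_onI[OF G_cont])
      show "(\<lambda>x. G x * cis (real_of_int m * x)) \<in> borel_measurable P_X"
        by measurable
    qed (auto simp: norm_mult S_bound intro!: tendsto_intros S_lim)
    \<comment> \<open>The coefficient at a fixed frequency is exact as soon as N reaches
      |m|.\<close>
    have "eventually (\<lambda>N. c (- m) = (\<integral>x. S N x * cis (of_int m * x) \<partial>P_X)) sequentially"
      using eventually_ge_at_top[of "nat \<bar>m\<bar>"] by eventually_elim (auto simp: S_coeff)
    then show "(\<lambda>N. \<integral>x. S N x * cis (of_int m * x) \<partial>P_X) \<longlonglongrightarrow> c (- m)"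
      by (rule Lim_transform_eventually[OF tendsto_const])
  qed
  have "of_real (f x) - G x = 0" for x
  proof (rule fourier_coeffs_zero_imp_zero)
    show "continuous_on UNIV (\<lambda>x. complex_of_real (f x) - G x)"
      by (intro continuous_intros f G_cont)
    show "complex_of_real (f (x + 2 * pi)) - G (x + 2 * pi) = complex_of_real (f x) - G x" for x
      using f(2) by (simp add: periodic2pi_def G_per)
    show "(\<integral>x. (complex_of_real (f x) - G x) * cis (of_int m * x) \<partial>P_X) = 0" for m
    proof -
      have "(\<integral>x. (complex_of_real (f x) - G x) * cis (of_int m * x) \<partial>P_X) =
          (\<integral>x. complex_of_real (f x) * cis (of_int m * x) \<partial>P_X) - (\<integral>x. G x * cis (of_int m * x) \<partial>P_X)"
        unfolding left_diff_distrib
        by (intro Bochner_Integration.integral_diff integrable_P_X_continuous continuous_intros f G_cont)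
      then show ?thesis
        by (simp add: G_coeff c_def)
    qed
  qed
  then have "G x = of_real (f x)" for x
    by simp
  then show ?thesis
    using coeff_le S_lim c0 unfolding S_def
    by (intro exI[of _ c] exI[of _ "suminf M"]) (auto simp: wiener_algebra_def)
qed

section \<open>Dilated sums in the Wiener algebra\<close>

context wiener_algebra
begin

definition partial_sum :: "nat \<Rightarrow> real \<Rightarrow> complex" where
  "partial_sum N x = (\<Sum>m\<in>{- int N..int N}. c m * cis (of_int m * x))"

lemma partial_sum_measurable [measurable]: "partial_sum N \<in> borel_measurable borel"
  unfolding partial_sum_def by measurable

lemma partial_sum_tendsto: "(\<lambda>N. partial_sum N x) \<longlonglongrightarrow> of_real (f x)"
  unfolding partial_sum_def by (rule fourier_sums)

lemma norm_partial_sum_le: "cmod (partial_sum N x) \<le> A"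
  unfolding partial_sum_def by (rule order.trans[OF norm_sum order.trans[OF _ coeff_sum_le[of N]]]) (simp add: norm_mult)

lemma A_nonneg: "0 \<le> A"
  using norm_partial_sum_le norm_ge_zero by (rule order.trans[rotated])

lemma abs_f_le: "\<bar>f x\<bar> \<le> A"
  using tendsto_upperbound[OF tendsto_norm[OF partial_sum_tendsto] always_eventually[OF allI[OF norm_partial_sum_le]]]
  by simp

lemma f_measurable [measurable]: "f \<in> borel_measurable borel"
proof -
  have "(\<lambda>x. complex_of_real (f x)) \<in> borel_measurable borel"
    by (rule borel_measurable_LIMSEQ_metric[OF _ partial_sum_tendsto]) auto
  then have "(\<lambda>x. Re (complex_of_real (f x))) \<in> borel_measurable borel"
    by measurable
  then show ?thesis by simp
qed

text \<open>The bound for trigonometric polynomials does not depend on the degree N, so it survives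
  dominated convergence of the partial sums to f.\<close>

lemma dilated_sum_bound:
  fixes b :: "nat \<Rightarrow> real"
  shows "(\<integral>x. (\<Sum>k\<in>I. b k * f (real k * x))\<^sup>2 \<partial>P_X) \<le> A\<^sup>2 * (\<Sum>k\<in>I. (b k)\<^sup>2)"
proof (rule tendsto_upperbound)
  let ?g = "\<lambda>N x. \<Sum>k\<in>I. b k * partial_sum N (real k * x)"
  have bound: "cmod (?g N x) \<le> (\<Sum>k\<in>I. \<bar>b k\<bar> * A)" for N x
    by (rule order.trans[OF norm_sum]) (auto simp: norm_mult intro!: sum_mono mult_left_mono norm_partial_sum_le)
  have lim: "(\<lambda>N. ?g N x) \<longlonglongrightarrow> (\<Sum>k\<in>I. complex_of_real (b k) * of_real (f (real k * x)))" for x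
    by (intro tendsto_intros partial_sum_tendsto)
  have "(\<lambda>N. \<integral>x. (cmod (?g N x))\<^sup>2 \<partial>P_X)
      \<longlonglongrightarrow> (\<integral>x. (cmod (\<Sum>k\<in>I. complex_of_real (b k) * of_real (f (real k * x))))\<^sup>2 \<partial>P_X)"
    by (rule integral_dominated_convergence[where w = "\<lambda>_. (\<Sum>k\<in>I. \<bar>b k\<bar> * A)\<^sup>2"])
       (auto intro!: power_mono bound tendsto_intros lim AE_I2)
  then show "(\<lambda>N. \<integral>x. (cmod (?g N x))\<^sup>2 \<partial>P_X) \<longlonglongrightarrow> (\<integral>x. (\<Sum>k\<in>I. b k * f (real k * x))\<^sup>2 \<partial>P_X)"
    by (simp flip: of_real_mult of_real_sum)
  have "(\<integral>x. (cmod (?g N x))\<^sup>2 \<partial>P_X) \<le> A\<^sup>2 * (\<Sum>k\<in>I. (b k)\<^sup>2)" for N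
  proof -
    \<comment> \<open>Frequency 0 has to leave the index set before the dilation bound applies; its
      coefficient is 0 anyway.\<close>
    define J where "J = {- int N..int N} - {0}"
    have "partial_sum N x = (\<Sum>m\<in>J. c m * cis (of_int m * x))" for x
      unfolding partial_sum_def J_def by (rule sum.mono_neutral_right) (auto simp: coeff_zero)
    then have "(\<integral>x. (cmod (?g N x))\<^sup>2 \<partial>P_X) \<le> (\<Sum>m\<in>J. cmod (c m))\<^sup>2 * (\<Sum>k\<in>I. (cmod (b k))\<^sup>2)"
      using dilated_trig_poly_bound[where J = J and r = "\<lambda>m. m" and I = I and b = "\<lambda>k. complex_of_real (b k)" and w = c] by (simp add: J_def)
    also have "\<dots> \<le> A\<^sup>2 * (\<Sum>k\<in>I. (b k)\<^sup>2)"
    proof -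
      have "(\<Sum>m\<in>J. cmod (c m)) \<le> (\<Sum>m\<in>{- int N..int N}. cmod (c m))"
        by (rule sum_mono2) (auto simp: J_def)
      then have "(\<Sum>m\<in>J. cmod (c m)) \<le> A"
        using coeff_sum_le[of N] by linarith
      then show ?thesis
        by (auto intro!: mult_mono power_mono sum_nonneg)
    qed
    finally show ?thesis .
  qed
  then show "eventually (\<lambda>N. (\<integral>x. (cmod (?g N x))\<^sup>2 \<partial>P_X) \<le> A\<^sup>2 * (\<Sum>k\<in>I. (b k)\<^sup>2)) sequentially"
    by simp
qed simp

definition s2 :: real where
  "s2 = (\<integral>x. (f x)\<^sup>2 \<partial>P_X)"

text \<open>Squaring stays in the Wiener algebra, so the deviation of the ergodic averages of
  \<open>f\<^sup>2\<close> is bounded like a dilated sum.\<close>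

lemma ergodic_square_bound:
  assumes "n > 0"
  shows "(\<integral>x. ((\<Sum>k=1..n. (f (real k * x))\<^sup>2) / n - s2)\<^sup>2 \<partial>P_X) \<le> A^4 / n"
proof (rule tendsto_upperbound)
  define b where "b k = (1 / of_nat n :: complex)" for k :: nat
  \<comment> \<open>The constant term of the squared polynomial. Centering at \<open>s N\<close>
    rather than at its limit \<open>s2\<close> leaves only nonzero frequencies for every N.\<close>
  define s where "s N = (\<integral>x. (partial_sum N x)\<^sup>2 \<partial>P_X)" for N
  let ?g = "\<lambda>N x. (\<Sum>k=1..n. b k * ((partial_sum N (real k * x))\<^sup>2 - s N))"
  have s_bound: "cmod (s N) \<le> A\<^sup>2" for N
  proof -
    have "cmod (s N) \<le> (\<integral>x. cmod ((partial_sum N x)\<^sup>2) \<partial>P_X)"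
      unfolding s_def by (rule integral_norm_bound)
    also have "\<dots> \<le> (\<integral>x. A\<^sup>2 \<partial>P_X)"
      by (intro integral_mono integrable_P_X_bounded[where B = "A\<^sup>2"])
         (auto simp: norm_power intro!: power_mono norm_partial_sum_le)
    finally show ?thesis
      by (simp add: PX.prob_space[simplified])
  qed
  have s_lim: "s \<longlonglongrightarrow> of_real s2"
  proof -
    have "s \<longlonglongrightarrow> (\<integral>x. (complex_of_real (f x))\<^sup>2 \<partial>P_X)"
      unfolding s_def
      by (rule integral_dominated_convergence[where w = "\<lambda>_. A\<^sup>2"])
         (auto simp: norm_power intro!: power_mono norm_partial_sum_le tendsto_intros partial_sum_tendsto AE_I2)
    then show ?thesis
      by (simp add: s2_def flip: of_real_power)
  qed
  have "cmod ((partial_sum N x)\<^sup>2 - s N) \<le> A\<^sup>2 + A\<^sup>2" for N x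
    by (intro order.trans[OF norm_triangle_ineq4] add_mono s_bound)
       (auto simp: norm_power intro!: power_mono norm_partial_sum_le)
  then have "cmod (?g N x) \<le> (\<Sum>k=1..n. cmod (b k) * (A\<^sup>2 + A\<^sup>2))" for N x
    by (intro order.trans[OF norm_sum] sum_mono) (simp only: norm_mult, intro mult_left_mono norm_ge_zero)
  then obtain W where bound: "cmod (?g N x) \<le> W" for N x
    by (rule that)
  have lim: "(\<lambda>N. ?g N x) \<longlonglongrightarrow> (\<Sum>k=1..n. b k * ((of_real (f (real k * x)))\<^sup>2 - of_real s2))" for x
    by (intro tendsto_intros partial_sum_tendsto s_lim)
  have "(\<lambda>N. \<integral>x. (cmod (?g N x))\<^sup>2 \<partial>P_X)
      \<longlonglongrightarrow> (\<integral>x. (cmod (\<Sum>k=1..n. b k * ((of_real (f (real k * x)))\<^sup>2 - of_real s2)))\<^sup>2 \<partial>P_X)"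
  proof (rule integral_dominated_convergence[where w = "\<lambda>_. W\<^sup>2"])
    show "AE x in P_X. (\<lambda>N. (cmod (?g N x))\<^sup>2)
        \<longlonglongrightarrow> (cmod (\<Sum>k=1..n. b k * ((of_real (f (real k * x)))\<^sup>2 - of_real s2)))\<^sup>2"
      by (intro AE_I2 tendsto_power tendsto_norm lim)
    show "AE x in P_X. norm ((cmod (?g N x))\<^sup>2) \<le> W\<^sup>2" for N
      unfolding norm_power unfolding real_norm_def abs_norm_cancel by (intro AE_I2 power_mono bound norm_ge_zero)
  qed simp_all
  moreover have "(\<Sum>k=1..n. b k * ((complex_of_real (f (real k * x)))\<^sup>2 - of_real s2)) =
      of_real ((\<Sum>k=1..n. (f (real k * x))\<^sup>2) / n - s2)" for x
    using assms by (simp add: b_def sum_subtractf right_diff_distrib flip: sum_divide_distrib)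
  ultimately show "(\<lambda>N. \<integral>x. (cmod (?g N x))\<^sup>2 \<partial>P_X)
      \<longlonglongrightarrow> (\<integral>x. ((\<Sum>k=1..n. (f (real k * x))\<^sup>2) / n - s2)\<^sup>2 \<partial>P_X)"
    by (simp del: of_real_diff)
  have "(\<integral>x. (cmod (?g N x))\<^sup>2 \<partial>P_X) \<le> A^4 / n" for N
  proof -
    define B where "B = {- int N..int N} \<times> {- int N..int N}"
    \<comment> \<open>The square is a sum over pairs of frequencies. Pairs with sum 0 make up
      \<open>s N\<close> exactly and disappear; many of the remaining pairs share a
      frequency.\<close>
    define J where "J = {p \<in> B. fst p + snd p \<noteq> 0}"
    define w where "w p = c (fst p) * c (snd p)" for p
    define r where "r p = fst p + snd p" for p :: "int \<times> int"
    have fin: "finite B" by (simp add: B_def)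
    have sq: "(partial_sum N x)\<^sup>2 = (\<Sum>p\<in>B. w p * cis (of_int (r p) * x))" for x
      unfolding power2_eq_square partial_sum_def sum_product B_def sum.cartesian_product
      by (intro sum.cong refl) (auto simp: w_def r_def mult_ac cis_mult distrib_left)
    have "s N = (\<Sum>p\<in>B. \<integral>x. w p * cis (of_int (r p) * x) \<partial>P_X)"
      unfolding s_def sq
      by (intro Bochner_Integration.integral_sum integrable_P_X_continuous continuous_intros)
    also have "\<dots> = (\<Sum>p\<in>B. if r p = 0 then w p else 0)"
      by (intro sum.cong refl) (simp add: integral_cis)
    finally have "(partial_sum N x)\<^sup>2 - s N = (\<Sum>p\<in>B. if r p = 0 then 0 else w p * cis (of_int (r p) * x))" for x
      unfolding sq by (simp add: sum_subtractf[symmetric]) (intro sum.cong; simp)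
    also have "(\<lambda>x. (\<Sum>p\<in>B. if r p = 0 then 0 else w p * cis (of_int (r p) * x))) = 
        (\<lambda>x. \<Sum>p\<in>J. w p * cis (of_int (r p) * x))"
      unfolding J_def by (intro ext sum.mono_neutral_cong_right) (auto simp: fin r_def)
    finally have eq: "(partial_sum N x)\<^sup>2 - s N = (\<Sum>p\<in>J. w p * cis (of_int (r p) * x))" for x .
    have "(\<integral>x. (cmod (?g N x))\<^sup>2 \<partial>P_X) \<le> (\<Sum>p\<in>J. cmod (w p))\<^sup>2 * (\<Sum>k=1..n. (cmod (b k))\<^sup>2)"
      unfolding eq by (rule dilated_trig_poly_bound) (auto simp: J_def r_def)
    also have "\<dots> \<le> (A\<^sup>2)\<^sup>2 * (\<Sum>k=1..n. (cmod (b k))\<^sup>2)"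
    proof -
      have "(\<Sum>p\<in>J. cmod (w p)) \<le> (\<Sum>p\<in>B. cmod (w p))"
        by (rule sum_mono2) (auto simp: J_def fin)
      also have "\<dots> = (\<Sum>m\<in>{- int N..int N}. cmod (c m))\<^sup>2"
        unfolding power2_eq_square sum_product B_def sum.cartesian_product
        by (intro sum.cong refl) (auto simp: w_def norm_mult)
      also have "\<dots> \<le> A\<^sup>2"
        by (intro power_mono coeff_sum_le sum_nonneg) auto
      finally show ?thesis
        by (intro mult_right_mono power_mono sum_nonneg) auto
    qed
    also have "\<dots> = A^4 / n"
      using assms by (simp add: b_def norm_divide power2_eq_square eval_nat_numeral)
    finally show ?thesis .
  qed
  then show "eventually (\<lambda>N. (\<integral>x. (cmod (?g N x))\<^sup>2 \<partial>P_X) \<le> A^4 / n) sequentially"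
    by simp
qed simp

end

section \<open>Gaussian approximation and second moments\<close>

text \<open>The upper bound rests on (1 - u + u^2/2)(1 + u + u^2/2) = 1 + u^4/4 >= 1, together with
  exp u >= 1 + u + u^2/2. It thus holds for all u >= 0, not only for small ones.\<close>

lemma exp_minus_approx:
  fixes u :: real
  assumes "u \<ge> 0"
  shows "\<bar>exp (- u) - (1 - u)\<bar> \<le> u\<^sup>2 / 2"
proof -
  have "1 - u \<le> exp (- u)"
    using exp_ge_add_one_self[of "- u"] by simp
  moreover have "exp (- u) \<le> 1 - u + u\<^sup>2 / 2"
  proof -
    have "1 + u + u\<^sup>2 / 2 \<le> exp u"
      using exp_lower_Taylor_quadratic[OF assms] .
    moreover have *: "1 - u + u\<^sup>2 / 2 = ((1 - u)\<^sup>2 + 1) / 2"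
      by (simp add: power2_eq_square algebra_simps)
    have "1 - u + u\<^sup>2 / 2 \<ge> 0"
      unfolding * by simp
    ultimately have "(1 - u + u\<^sup>2 / 2) * (1 + u + u\<^sup>2 / 2) \<le> (1 - u + u\<^sup>2 / 2) * exp u"
      by (intro mult_left_mono)
    moreover have "(1 - u + u\<^sup>2 / 2) * (1 + u + u\<^sup>2 / 2) = 1 + (u\<^sup>2)\<^sup>2 / 4"
      by (simp add: power2_eq_square algebra_simps)
    ultimately have "1 \<le> (1 - u + u\<^sup>2 / 2) * exp u"
      using zero_le_power2[of "u\<^sup>2"] by linarith
    then have "exp (- u) * 1 \<le> exp (- u) * ((1 - u + u\<^sup>2 / 2) * exp u)"
      by (intro mult_left_mono) auto
    then show ?thesis
      by (simp add: exp_minus field_simps)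
  qed
  ultimately show ?thesis by auto
qed

lemma exp_minus_lipschitz:
  fixes u v :: real
  assumes "u \<ge> 0" "v \<ge> 0"
  shows "\<bar>exp (- u) - exp (- v)\<bar> \<le> \<bar>u - v\<bar>"
proof -
  have *: "exp (- u) - exp (- v) \<le> v - u" if "0 \<le> u" "u \<le> v" for u v :: real
  proof -
    have "exp (- u) - exp (- v) = exp (- u) * (1 - exp (u - v))"
      by (simp add: algebra_simps flip: exp_add)
    also have "\<dots> \<le> 1 * (1 - exp (u - v))"
      using that by (intro mult_right_mono) auto
    also have "\<dots> \<le> v - u"
      using exp_ge_add_one_self[of "u - v"] unfolding mult_1 by linarith
    finally show ?thesis .
  qed
  show ?thesis
    using *[of u v] *[of v u] assms by (cases "u \<le> v") (auto simp: abs_if)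
qed

text \<open>Both functions are compared with the common quadratic 1 - t^2/2. The factors 1/6 and 1/8
  that arise are simply replaced by 1.\<close>

lemma (in real_distribution) char_gaussian_approx:
  assumes 1: "integrable M (\<lambda>x. x)" "expectation (\<lambda>x. x) = 0"
    and 2: "integrable M (\<lambda>x. x\<^sup>2)" "expectation (\<lambda>x. x\<^sup>2) = 1"
    and 3: "integrable M (\<lambda>x. \<bar>x\<bar> ^ 3)"
  shows "cmod (char M t - complex_of_real (exp (- (t\<^sup>2 / 2)))) \<le> \<bar>t\<bar> ^ 3 * expectation (\<lambda>x. \<bar>x\<bar> ^ 3) + t ^ 4"
proof -
  have "cmod (char M t - of_real (1 - t\<^sup>2 * 1 / 2)) \<le> (t\<^sup>2 / 6) * expectation (\<lambda>x. min (6 * x\<^sup>2) (\<bar>t\<bar> * \<bar>x\<bar> ^ 3))"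
    using char_approx3[of 1 t] 1 2 by simp
  also have "\<dots> \<le> (t\<^sup>2 / 6) * expectation (\<lambda>x. \<bar>t\<bar> * \<bar>x\<bar> ^ 3)"
    using 2 3 by (intro mult_left_mono integral_mono integrable_min) auto
  also have "\<dots> = \<bar>t\<bar> ^ 3 * expectation (\<lambda>x. \<bar>x\<bar> ^ 3) / 6"
  proof -
    have "\<bar>t\<bar> ^ 3 = t\<^sup>2 * \<bar>t\<bar>"
      by (metis mult.commute numeral_2_eq_2 numeral_3_eq_3 power2_abs power_Suc)
    then show ?thesis by simp
  qed
  also have "\<dots> \<le> \<bar>t\<bar> ^ 3 * expectation (\<lambda>x. \<bar>x\<bar> ^ 3)"
    by simp
  finally have A: "cmod (char M t - of_real (1 - t\<^sup>2 * 1 / 2)) \<le> \<bar>t\<bar> ^ 3 * expectation (\<lambda>x. \<bar>x\<bar> ^ 3)" .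
  define r where "r = \<bar>exp (- (t\<^sup>2 / 2)) - (1 - t\<^sup>2 * 1 / 2)\<bar>"
  have "r \<ge> 0"
    by (simp add: r_def)
  have "r * 8 \<le> t ^ 4"
    using exp_minus_approx[of "t\<^sup>2 / 2"] by (simp add: r_def power_divide flip: power_mult)
  then have "r \<le> t ^ 4"
    using \<open>r \<ge> 0\<close> by linarith
  then have B: "cmod (of_real (1 - t\<^sup>2 * 1 / 2) - of_real (exp (- (t\<^sup>2 / 2)))) \<le> t ^ 4"
    unfolding of_real_diff[symmetric] norm_of_real by (simp add: r_def abs_minus_commute)
  show ?thesis
    using norm_triangle_ineq[of "char M t - of_real (1 - t\<^sup>2 * 1 / 2)" "of_real (1 - t\<^sup>2 * 1 / 2) - of_real (exp (- (t\<^sup>2 / 2)))"] A B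
    by simp
qed

text \<open>Integrability need not be checked: a non-integrable function has integral 0, and B is
  nonnegative.\<close>

lemma (in prob_space) norm_integral_le:
  fixes g :: "'a \<Rightarrow> 'b::{banach, second_countable_topology}"
  assumes "\<And>x. norm (g x) \<le> B"
  shows "norm (\<integral>x. g x \<partial>M) \<le> B"
proof (cases "integrable M g")
  case True
  then have "(\<integral>x. norm (g x) \<partial>M) \<le> B"
    using assms by (intro integral_le_const) auto
  then show ?thesis
    using integral_norm_bound[of M g] by linarith
next
  case False
  then show ?thesis
    using order.trans[OF norm_ge_zero assms] by (simp add: not_integrable_integral_eq)
qed

lemma measurable_cnj [measurable]: "cnj \<in> borel_measurable borel"
  by (intro borel_measurable_continuous_onI continuous_intros)

lemma (in pair_prob_space) integral_swap_bounded:
  fixes F :: "'a \<Rightarrow> 'b \<Rightarrow> 'c::{banach, second_countable_topology}"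
  assumes [measurable]: "case_prod F \<in> borel_measurable (M1 \<Otimes>\<^sub>M M2)" and "\<And>x y. norm (F x y) \<le> B"
  shows "(\<integral>x. \<integral>y. F x y \<partial>M2 \<partial>M1) = (\<integral>y. \<integral>x. F x y \<partial>M1 \<partial>M2)"
proof -
  have "integrable (M1 \<Otimes>\<^sub>M M2) (case_prod F)"
    using assms(2) by (intro P.integrable_const_bound[where B = B]) (auto split: prod.split)
  from Fubini_integral[OF this] show ?thesis ..
qed

text \<open>With \<open>\<Phi> w\<close> the inner integral, the squared modulus of
  \<open>\<Phi> w\<close> is a double integral over x and y, and Fubini moves the integral over w
  inside. The comparison is then with c for one point and with the square of c for two
  points.\<close>

lemma (in pair_prob_space) second_moment_fubini:
  fixes Z :: "'a \<Rightarrow> 'b \<Rightarrow> complex" and c :: real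
  assumes meas [measurable]: "case_prod Z \<in> borel_measurable (M1 \<Otimes>\<^sub>M M2)" and bound: "\<And>w x. norm (Z w x) \<le> 1"
  shows "(\<integral>w. (cmod ((\<integral>x. Z w x \<partial>M2) - c))\<^sup>2 \<partial>M1) \<le>
     (\<integral>x. (\<integral>y. cmod ((\<integral>w. Z w x * cnj (Z w y) \<partial>M1) - c\<^sup>2) \<partial>M2) \<partial>M2)
       + 2 * \<bar>c\<bar> * (\<integral>x. cmod ((\<integral>w. Z w x \<partial>M1) - c) \<partial>M2)"
proof -
  define \<Phi> where "\<Phi> w = (\<integral>x. Z w x \<partial>M2)" for w
  have [measurable]: "\<Phi> \<in> borel_measurable M1"
    unfolding \<Phi>_def by measurable
  have \<Phi>_bound: "cmod (\<Phi> w) \<le> 1" for w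
    unfolding \<Phi>_def by (intro M2.norm_integral_le bound)
  define a where "a x = (\<integral>w. Z w x \<partial>M1)" for x
  define b where "b x y = (\<integral>w. Z w x * cnj (Z w y) \<partial>M1)" for x y
  have int\<Phi>: "integrable M1 \<Phi>"
    using \<Phi>_bound by (intro M1.integrable_const_bound[where B = 1]) auto
  have [measurable]: "a \<in> borel_measurable M2"
    unfolding a_def by measurable
  have [measurable]: "case_prod b \<in> borel_measurable (M2 \<Otimes>\<^sub>M M2)"
    unfolding b_def by measurable
  have a_bound: "cmod (a x) \<le> 1" for x
    unfolding a_def by (intro M1.norm_integral_le bound)
  have b_bound: "cmod (b x y) \<le> 1" for x y
    unfolding b_def by (intro M1.norm_integral_le) (simp add: bound norm_mult mult_le_one)
  have E1: "(\<integral>w. \<Phi> w \<partial>M1) = (\<integral>x. a x \<partial>M2)"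
    unfolding \<Phi>_def a_def by (rule integral_swap_bounded[OF _ bound]) measurable
  have "(\<integral>w. \<Phi> w * cnj (\<Phi> w) \<partial>M1) = (\<integral>w. \<integral>x. Z w x * cnj (\<Phi> w) \<partial>M2 \<partial>M1)"
    by (simp add: \<Phi>_def)
  also have "\<dots> = (\<integral>x. \<integral>w. Z w x * cnj (\<Phi> w) \<partial>M1 \<partial>M2)"
    by (rule integral_swap_bounded[where B = 1]) (auto simp: norm_mult intro!: mult_le_one bound \<Phi>_bound)
  also have "\<dots> = (\<integral>x. \<integral>w. \<integral>y. Z w x * cnj (Z w y) \<partial>M2 \<partial>M1 \<partial>M2)"
    by (simp add: \<Phi>_def)
  also have "\<dots> = (\<integral>x. \<integral>y. b x y \<partial>M2 \<partial>M2)"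
    unfolding b_def
    by (intro Bochner_Integration.integral_cong refl integral_swap_bounded[where B = 1])
       (auto simp: norm_mult intro!: mult_le_one bound)
  finally have E2: "(\<integral>w. \<Phi> w * cnj (\<Phi> w) \<partial>M1) = (\<integral>x. \<integral>y. b x y \<partial>M2 \<partial>M2)" .
  have int2: "integrable M1 (\<lambda>w. \<Phi> w * cnj (\<Phi> w))"
    by (intro M1.integrable_const_bound[where B = 1]) (auto simp: norm_mult intro!: mult_le_one \<Phi>_bound)
  have intb: "integrable M2 (\<lambda>y. b x y)" if "x \<in> space M2" for x
    using that by (intro M2.integrable_const_bound[where B = 1]) (auto intro!: b_bound)
  have ib_bound: "cmod (\<integral>y. b x y \<partial>M2) \<le> 1" for x
    by (intro M2.norm_integral_le b_bound)
  have intbb: "integrable M2 (\<lambda>x. \<integral>y. b x y \<partial>M2)"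
    by (intro M2.integrable_const_bound[where B = 1]) (auto intro!: ib_bound)
  have inta: "integrable M2 a"
    by (intro M2.integrable_const_bound[where B = 1]) (auto intro!: a_bound)
  have "complex_of_real ((cmod (\<Phi> w - c))\<^sup>2) = \<Phi> w * cnj (\<Phi> w) - c * (\<Phi> w) - c * cnj (\<Phi> w) + c\<^sup>2" for w
    by (simp only: complex_norm_square) (simp add: power2_eq_square algebra_simps)
  then have "complex_of_real (\<integral>w. (cmod (\<Phi> w - c))\<^sup>2 \<partial>M1) =
      (\<integral>w. \<Phi> w * cnj (\<Phi> w) - c * (\<Phi> w) - c * cnj (\<Phi> w) + c\<^sup>2 \<partial>M1)"
    by (simp only: flip: integral_complex_of_real)
  also have "\<dots> = (\<integral>x. \<integral>y. b x y \<partial>M2 \<partial>M2) - c * (\<integral>x. a x \<partial>M2) - c * cnj (\<integral>x. a x \<partial>M2) + c\<^sup>2"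
    using int2 int\<Phi> by (simp add: E2 M1.prob_space flip: E1)
  \<comment> \<open>Centering b and a shifts the constant by c^2 - c^2 - c^2, which the free term
    c^2 cancels. Only differences from the targets remain.\<close>
  also have "\<dots> = (\<integral>x. (\<integral>y. b x y - c\<^sup>2 \<partial>M2) \<partial>M2) - c * (\<integral>x. a x - c \<partial>M2) - c * cnj (\<integral>x. a x - c \<partial>M2)"
  proof -
    have "(\<integral>x. (\<integral>y. b x y - complex_of_real (c\<^sup>2) \<partial>M2) \<partial>M2) = (\<integral>x. (\<integral>y. b x y \<partial>M2) - complex_of_real (c\<^sup>2) \<partial>M2)"
      by (intro Bochner_Integration.integral_cong refl) (simp add: intb M2.prob_space)
    then show ?thesis
      using intbb inta by (simp add: M2.prob_space algebra_simps power2_eq_square)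
  qed
  finally have eq: "complex_of_real (\<integral>w. (cmod (\<Phi> w - c))\<^sup>2 \<partial>M1) =
      (\<integral>x. (\<integral>y. b x y - c\<^sup>2 \<partial>M2) \<partial>M2) - c * (\<integral>x. a x - c \<partial>M2) - c * cnj (\<integral>x. a x - c \<partial>M2)" .
  have "(\<integral>w. (cmod (\<Phi> w - c))\<^sup>2 \<partial>M1) =
      cmod ((\<integral>x. (\<integral>y. b x y - c\<^sup>2 \<partial>M2) \<partial>M2) - c * (\<integral>x. a x - c \<partial>M2) - c * cnj (\<integral>x. a x - c \<partial>M2))"
    unfolding eq[symmetric] norm_of_real by (rule abs_of_nonneg[symmetric], rule Bochner_Integration.integral_nonneg) simp
  also have "\<dots> \<le> cmod (\<integral>x. (\<integral>y. b x y - c\<^sup>2 \<partial>M2) \<partial>M2) + \<bar>c\<bar> * cmod (\<integral>x. a x - c \<partial>M2) + \<bar>c\<bar> * cmod (\<integral>x. a x - c \<partial>M2)"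
    by (rule order.trans[OF norm_triangle_ineq4 add_mono[OF order.trans[OF norm_triangle_ineq4]]]) (auto simp: norm_mult)
  finally have le: "(\<integral>w. (cmod (\<Phi> w - c))\<^sup>2 \<partial>M1) \<le> cmod (\<integral>x. (\<integral>y. b x y - c\<^sup>2 \<partial>M2) \<partial>M2) +
      \<bar>c\<bar> * cmod (\<integral>x. a x - c \<partial>M2) + \<bar>c\<bar> * cmod (\<integral>x. a x - c \<partial>M2)" .
  have le_b: "cmod (\<integral>x. (\<integral>y. b x y - c\<^sup>2 \<partial>M2) \<partial>M2) \<le> (\<integral>x. (\<integral>y. cmod (b x y - c\<^sup>2) \<partial>M2) \<partial>M2)"
  proof (rule order.trans[OF integral_norm_bound], rule integral_mono)
    have 2: "cmod (b x y - c\<^sup>2) \<le> 1 + c\<^sup>2" for x y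
      by (rule order.trans[OF norm_triangle_ineq4 add_mono[OF b_bound]]) (simp add: norm_power)
    have 3: "norm (\<integral>y. cmod (b x y - c\<^sup>2) \<partial>M2) \<le> 1 + c\<^sup>2" for x
      by (intro M2.norm_integral_le) (use 2 in simp)
    have 4: "cmod (\<integral>y. b x y - c\<^sup>2 \<partial>M2) \<le> (\<integral>y. cmod (b x y - c\<^sup>2) \<partial>M2)" for x
      by (rule integral_norm_bound)
    show "cmod (\<integral>y. b x y - c\<^sup>2 \<partial>M2) \<le> (\<integral>y. cmod (b x y - c\<^sup>2) \<partial>M2)" for x
      by (rule 4)
    show "integrable M2 (\<lambda>x. cmod (\<integral>y. b x y - c\<^sup>2 \<partial>M2))"
      by (intro M2.integrable_const_bound[where B = "1 + c\<^sup>2"])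
         (auto simp del: of_real_power intro!: M2.norm_integral_le 2)
    show "integrable M2 (\<lambda>x. \<integral>y. cmod (b x y - c\<^sup>2) \<partial>M2)"
      by (intro M2.integrable_const_bound[where B = "1 + c\<^sup>2"])
         (use 3 in auto)
  qed
  have "\<bar>c\<bar> * cmod (\<integral>x. a x - c \<partial>M2) \<le> \<bar>c\<bar> * (\<integral>x. cmod (a x - c) \<partial>M2)"
    by (intro mult_left_mono integral_norm_bound) simp
  then have "(\<integral>w. (cmod (\<Phi> w - c))\<^sup>2 \<partial>M1) \<le>
      (\<integral>x. (\<integral>y. cmod (b x y - c\<^sup>2) \<partial>M2) \<partial>M2) + 2 * \<bar>c\<bar> * (\<integral>x. cmod (a x - c) \<partial>M2)"
    using le le_b by linarith
  then show ?thesis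
    by (simp only: \<Phi>_def a_def b_def)
qed

section \<open>Characteristic functions of weighted sums of the random coefficients\<close>

locale random_wiener_sum = wiener_algebra f c A + prob_space M
  for f :: "real \<Rightarrow> real" and c :: "int \<Rightarrow> complex" and A :: real and M :: "'w measure" +
  fixes a :: "nat \<Rightarrow> 'w \<Rightarrow> real"
  assumes indep: "indep_vars (\<lambda>_. borel) a {1..}"
    and ident: "\<And>k. k \<ge> 1 \<Longrightarrow> distr M borel (a k) = distr M borel (a 1)"
    and centered: "\<And>k. k \<ge> 1 \<Longrightarrow> expectation (a k) = 0"
    and variance_one: "\<And>k. k \<ge> 1 \<Longrightarrow> variance (a k) = 1"
    and third_moment: "\<And>k. k \<ge> 1 \<Longrightarrow> integrable M (\<lambda>\<omega>. \<bar>a k \<omega>\<bar> ^ 3)"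
begin

sublocale MX: pair_prob_space M P_X ..

lemma a_measurable [measurable (raw)]: "k \<ge> 1 \<Longrightarrow> a k \<in> borel_measurable M"
  using indep by (auto simp: indep_vars_def)

text \<open>The third moment dominates the lower ones through x^2 <= 1 + |x|^3.\<close>

lemma integrable_a_square: "k \<ge> 1 \<Longrightarrow> integrable M (\<lambda>\<omega>. (a k \<omega>)\<^sup>2)"
proof (rule Bochner_Integration.integrable_bound)
  assume k: "k \<ge> 1"
  show "integrable M (\<lambda>\<omega>. 1 + \<bar>a k \<omega>\<bar> ^ 3)"
    using third_moment[OF k] by simp
  have "x\<^sup>2 \<le> 1 + \<bar>x\<bar> ^ 3" for x :: real
  proof (cases "\<bar>x\<bar> \<le> 1")
    case True
    then have "\<bar>x\<bar>\<^sup>2 \<le> 1"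
      by (intro power_le_one) auto
    moreover have "0 \<le> \<bar>x\<bar> ^ 3"
      by simp
    ultimately show ?thesis
      unfolding power2_abs by linarith
  next
    case False
    then have "\<bar>x\<bar> ^ 2 \<le> \<bar>x\<bar> ^ 3"
      by (intro power_increasing) auto
    then show ?thesis by simp
  qed
  then show "AE \<omega> in M. norm ((a k \<omega>)\<^sup>2) \<le> norm (1 + \<bar>a k \<omega>\<bar> ^ 3)"
    by (intro AE_I2) (simp add: abs_of_nonneg)
qed (auto intro: a_measurable)

lemma integrable_a: "k \<ge> 1 \<Longrightarrow> integrable M (a k)"
  by (rule square_integrable_imp_integrable[OF a_measurable integrable_a_square])

lemma a_second_moment: "k \<ge> 1 \<Longrightarrow> expectation (\<lambda>\<omega>. (a k \<omega>)\<^sup>2) = 1"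
  using variance_one[of k] centered[of k] by simp

definition \<mu> where "\<mu> = distr M borel (a 1)"

sublocale \<mu>: real_distribution \<mu>
  unfolding \<mu>_def by (intro real_distribution_distr a_measurable) simp

lemma expectation_via_\<mu>:
  fixes g :: "real \<Rightarrow> 'b::{banach, second_countable_topology}"
  assumes "k \<ge> 1" and [measurable]: "g \<in> borel_measurable borel"
  shows "expectation (\<lambda>\<omega>. g (a k \<omega>)) = (\<integral>x. g x \<partial>\<mu>)"
    and "integrable M (\<lambda>\<omega>. g (a k \<omega>)) \<longleftrightarrow> integrable \<mu> g"
proof -
  have \<mu>: "\<mu> = distr M borel (a k)"
    unfolding \<mu>_def by (rule ident[OF assms(1), symmetric])
  show "expectation (\<lambda>\<omega>. g (a k \<omega>)) = (\<integral>x. g x \<partial>\<mu>)"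
    unfolding \<mu> by (rule integral_distr[OF a_measurable[OF assms(1)] assms(2), symmetric])
  show "integrable M (\<lambda>\<omega>. g (a k \<omega>)) \<longleftrightarrow> integrable \<mu> g"
    unfolding \<mu> by (rule integrable_distr_eq[OF a_measurable[OF assms(1)] assms(2), symmetric])
qed

definition \<rho> :: real where "\<rho> = (\<integral>x. \<bar>x\<bar> ^ 3 \<partial>\<mu>)"

lemma a_third_moment: "k \<ge> 1 \<Longrightarrow> expectation (\<lambda>\<omega>. \<bar>a k \<omega>\<bar> ^ 3) = \<rho>"
  unfolding \<rho>_def by (rule expectation_via_\<mu>(1)) simp_all

lemma \<rho>_nonneg: "\<rho> \<ge> 0"
  unfolding \<rho>_def by (rule Bochner_Integration.integral_nonneg) simp

lemma char_\<mu>_approx: "cmod (char \<mu> t - complex_of_real (exp (- (t\<^sup>2 / 2)))) \<le> \<bar>t\<bar> ^ 3 * \<rho> + t ^ 4"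
  unfolding \<rho>_def
proof (rule \<mu>.char_gaussian_approx)
  show "integrable \<mu> (\<lambda>x. x)" "\<mu>.expectation (\<lambda>x. x) = 0"
    using expectation_via_\<mu>[of 1 "\<lambda>x. x"] integrable_a[of 1] centered[of 1] by simp_all
  show "integrable \<mu> (\<lambda>x. x\<^sup>2)" "\<mu>.expectation (\<lambda>x. x\<^sup>2) = 1"
    using expectation_via_\<mu>[of 1 "\<lambda>x. x\<^sup>2"] integrable_a_square[of 1] a_second_moment[of 1] by simp_all
  show "integrable \<mu> (\<lambda>x. \<bar>x\<bar> ^ 3)"
    using expectation_via_\<mu>[of 1 "\<lambda>x. \<bar>x\<bar> ^ 3"] third_moment[of 1] by simp
qed

lemma expectation_cis_sum:
  fixes s :: "nat \<Rightarrow> real"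
  assumes "finite I" "I \<subseteq> {1..}"
  shows "expectation (\<lambda>\<omega>. cis (\<Sum>k\<in>I. s k * a k \<omega>)) = (\<Prod>k\<in>I. char \<mu> (s k))"
proof -
  have cis_sum: "cis (\<Sum>k\<in>I. g k) = (\<Prod>k\<in>I. cis (g k))" for g
    using assms(1) by (induction rule: finite_induct) (auto simp flip: cis_mult)
  have "indep_vars (\<lambda>_. borel) (\<lambda>k \<omega>. cis (s k * a k \<omega>)) I"
    by (rule indep_vars_compose2[OF indep_vars_subset[OF indep assms(2)], where Y = "\<lambda>k x. cis (s k * x)"]) measurable
  then have "expectation (\<lambda>\<omega>. cis (\<Sum>k\<in>I. s k * a k \<omega>)) = (\<Prod>k\<in>I. expectation (\<lambda>\<omega>. cis (s k * a k \<omega>)))"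
    unfolding cis_sum using assms
    by (intro indep_vars_lebesgue_integral integrable_const_bound[where B = 1])
       (auto intro!: measurable_cis_comp borel_measurable_times a_measurable)
  also have "\<dots> = (\<Prod>k\<in>I. char \<mu> (s k))"
    using assms(2) unfolding char_def
    by (intro prod.cong refl, subst expectation_via_\<mu>(1)[where g = "\<lambda>x. cis (s _ * x)"])
       (auto simp: cis_conv_exp)
  finally show ?thesis .
qed

lemma clt_error:
  fixes v :: "nat \<Rightarrow> real"
  assumes "n > 0" and v: "\<And>k. \<bar>v k\<bar> \<le> K" and t: "\<bar>t\<bar> \<le> T" and "s \<ge> 0"
  shows "cmod (expectation (\<lambda>\<omega>. cis (t * (1 / sqrt n * (\<Sum>k=1..n. a k \<omega> * v k)))) - complex_of_real (exp (- (t\<^sup>2 / 2) * s)))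
    \<le> (\<rho> * (T * K) ^ 3 + (T * K) ^ 4) / sqrt n + T\<^sup>2 * \<bar>(\<Sum>k=1..n. (v k)\<^sup>2) / n - s\<bar>"
proof -
  define u where "u k = t * v k / sqrt n" for k
  define V where "V = (\<Sum>k=1..n. (v k)\<^sup>2) / n"
  have K: "K \<ge> 0" using v[of 0] by simp
  have T: "T \<ge> 0" using t by simp
  have "t * (1 / sqrt n * (\<Sum>k=1..n. a k \<omega> * v k)) = (\<Sum>k=1..n. u k * a k \<omega>)" for \<omega>
    unfolding u_def sum_distrib_left by (intro sum.cong) (auto simp: field_simps)
  then have E: "expectation (\<lambda>\<omega>. cis (t * (1 / sqrt n * (\<Sum>k=1..n. a k \<omega> * v k)))) = (\<Prod>k=1..n. char \<mu> (u k))"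
    using expectation_cis_sum[of "{1..n}" u] by simp
  have exp_V: "complex_of_real (exp (- (t\<^sup>2 / 2) * V)) = (\<Prod>k=1..n. complex_of_real (exp (- ((u k)\<^sup>2 / 2))))"
  proof -
    have "- (t\<^sup>2 / 2) * V = (\<Sum>k=1..n. - ((u k)\<^sup>2 / 2))"
      unfolding V_def u_def sum_divide_distrib sum_distrib_left by (intro sum.cong) (auto simp: power_divide power_mult_distrib)
    then show ?thesis
      by (simp add: exp_sum)
  qed
  have "cmod ((\<Prod>k=1..n. char \<mu> (u k)) - complex_of_real (exp (- (t\<^sup>2 / 2) * V)))
      \<le> (\<Sum>k=1..n. cmod (char \<mu> (u k) - complex_of_real (exp (- ((u k)\<^sup>2 / 2)))))"
    \<comment> \<open>Telescoping: all factors have modulus at most 1, so the errors only add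
      up.\<close>
    unfolding exp_V by (intro norm_prod_diff) (auto simp: \<mu>.cmod_char_le_1)
  moreover have "(\<Sum>k=1..n. cmod (char \<mu> (u k) - complex_of_real (exp (- ((u k)\<^sup>2 / 2)))))
      \<le> (\<Sum>k=1..n. (\<rho> * (T * K) ^ 3 + (T * K) ^ 4) / (n * sqrt n))"
  proof (rule sum_mono)
    fix k
    have u: "\<bar>u k\<bar> \<le> T * K / sqrt n"
      using v[of k] t T by (auto simp: u_def abs_mult intro!: divide_right_mono mult_mono)
    have "cmod (char \<mu> (u k) - complex_of_real (exp (- ((u k)\<^sup>2 / 2)))) \<le> \<bar>u k\<bar> ^ 3 * \<rho> + \<bar>u k\<bar> ^ 4"
      using char_\<mu>_approx[of "u k"] by simp
    also have "\<dots> \<le> (T * K / sqrt n) ^ 3 * \<rho> + (T * K / sqrt n) ^ 4"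
      by (intro add_mono mult_right_mono power_mono u \<rho>_nonneg) auto
    also have "(sqrt n) ^ 3 = n * sqrt n"
      by (simp add: power3_eq_cube)
    then have "(T * K / sqrt n) ^ 3 = (T * K) ^ 3 / (n * sqrt n)"
      by (simp only: power_divide)
    \<comment> \<open>The fourth-order term is even O(n^(-2)); it is weakened to n^(-3/2) to share a
      denominator with the cubic one.\<close>
    also have "(T * K / sqrt n) ^ 4 \<le> (T * K) ^ 4 / (n * sqrt n)"
    proof -
      have "real n * sqrt n \<le> real n * n"
        using \<open>n > 0\<close> by (intro mult_left_mono) (auto intro!: real_le_lsqrt simp: power2_eq_square)
      then have "n * sqrt n \<le> (sqrt n) ^ 4"
        by (simp add: power4_eq_xxxx mult.assoc)
      then show ?thesis
        unfolding power_divide using \<open>n > 0\<close> by (intro divide_left_mono) auto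
    qed
    finally show "cmod (char \<mu> (u k) - complex_of_real (exp (- ((u k)\<^sup>2 / 2)))) \<le>
        (\<rho> * (T * K) ^ 3 + (T * K) ^ 4) / (n * sqrt n)"
      by (simp add: add_divide_distrib mult.commute)
  qed
  moreover have "(\<Sum>k=1..n. (\<rho> * (T * K) ^ 3 + (T * K) ^ 4) / (n * sqrt n)) = (\<rho> * (T * K) ^ 3 + (T * K) ^ 4) / sqrt n"
    using \<open>n > 0\<close> by simp
  moreover have "cmod (complex_of_real (exp (- (t\<^sup>2 / 2) * V)) - complex_of_real (exp (- (t\<^sup>2 / 2) * s))) \<le> T\<^sup>2 * \<bar>V - s\<bar>"
  proof -
    have "V \<ge> 0"
      unfolding V_def by (intro divide_nonneg_nonneg sum_nonneg) auto
    then have "\<bar>exp (- (t\<^sup>2 / 2 * V)) - exp (- (t\<^sup>2 / 2 * s))\<bar> \<le> \<bar>t\<^sup>2 / 2 * V - t\<^sup>2 / 2 * s\<bar>"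
      using \<open>s \<ge> 0\<close> by (intro exp_minus_lipschitz) auto
    also have "\<dots> = (t\<^sup>2 / 2) * \<bar>V - s\<bar>"
      unfolding right_diff_distrib[symmetric] abs_mult by simp
    also have "\<dots> \<le> T\<^sup>2 * \<bar>V - s\<bar>"
    proof (rule mult_right_mono)
      have "\<bar>t\<bar>\<^sup>2 \<le> T\<^sup>2" by (intro power_mono t) auto
      then show "t\<^sup>2 / 2 \<le> T\<^sup>2"
        using zero_le_power2[of T] unfolding power2_abs by linarith
    qed auto
    finally show ?thesis
      by (simp flip: of_real_diff)
  qed
  moreover have "cmod ((\<Prod>k=1..n. char \<mu> (u k)) - complex_of_real (exp (- (t\<^sup>2 / 2) * s))) \<le>
      cmod ((\<Prod>k=1..n. char \<mu> (u k)) - complex_of_real (exp (- (t\<^sup>2 / 2) * V))) +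
      cmod (complex_of_real (exp (- (t\<^sup>2 / 2) * V)) - complex_of_real (exp (- (t\<^sup>2 / 2) * s)))"
    using dist_triangle[of "\<Prod>k=1..n. char \<mu> (u k)" "complex_of_real (exp (- (t\<^sup>2 / 2) * s))"
        "complex_of_real (exp (- (t\<^sup>2 / 2) * V))"]
    by (simp only: dist_norm)
  ultimately show ?thesis
    unfolding V_def[symmetric] E by linarith
qed

end

text \<open>Nonnegativity of the variance of |g|.\<close>

lemma (in prob_space) integral_abs_le_sqrt:
  fixes g :: "'a \<Rightarrow> real"
  assumes "g \<in> borel_measurable M" "integrable M (\<lambda>x. (g x)\<^sup>2)" "(\<integral>x. (g x)\<^sup>2 \<partial>M) \<le> B"
  shows "(\<integral>x. \<bar>g x\<bar> \<partial>M) \<le> sqrt B"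
proof -
  have int: "integrable M g"
    by (rule square_integrable_imp_integrable[OF assms(1,2)])
  have "0 \<le> variance (\<lambda>x. \<bar>g x\<bar>)"
    by (rule variance_positive)
  also have "variance (\<lambda>x. \<bar>g x\<bar>) = (\<integral>x. (g x)\<^sup>2 \<partial>M) - (\<integral>x. \<bar>g x\<bar> \<partial>M)\<^sup>2"
    using int assms(2) by (subst variance_eq) auto
  finally have "(\<integral>x. \<bar>g x\<bar> \<partial>M)\<^sup>2 \<le> B"
    using assms(3) by simp
  then show ?thesis
    by (rule real_le_rsqrt)
qed

section \<open>L1 bounds for dilated sums, ergodic averages and correlations\<close>

context wiener_algebra
begin

lemma s2_nonneg: "s2 \<ge> 0"
  unfolding s2_def by (rule Bochner_Integration.integral_nonneg) simp

lemma abs_sum_f_le: "\<bar>\<Sum>k\<in>I. b k * f (real k * x)\<bar> \<le> (\<Sum>k\<in>I. \<bar>b k\<bar> * A)"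
  by (rule order.trans[OF sum_abs]) (auto simp: abs_mult intro!: sum_mono mult_left_mono abs_f_le)

lemma integrable_dilated_sum_square: "integrable P_X (\<lambda>x. (\<Sum>k\<in>I. b k * f (real k * x))\<^sup>2)"
proof (rule integrable_P_X_bounded[where B = "(\<Sum>k\<in>I. \<bar>b k\<bar> * A)\<^sup>2"])
  show "norm ((\<Sum>k\<in>I. b k * f (real k * x))\<^sup>2) \<le> (\<Sum>k\<in>I. \<bar>b k\<bar> * A)\<^sup>2" for x
    using power_mono[OF abs_sum_f_le abs_ge_zero, of b x I 2] by simp
qed measurable

lemma integral_abs_dilated_sum:
  "(\<integral>x. \<bar>\<Sum>k\<in>I. b k * f (real k * x)\<bar> \<partial>P_X) \<le> A * sqrt (\<Sum>k\<in>I. (b k)\<^sup>2)"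
proof -
  have "(\<integral>x. \<bar>\<Sum>k\<in>I. b k * f (real k * x)\<bar> \<partial>P_X) \<le> sqrt (A\<^sup>2 * (\<Sum>k\<in>I. (b k)\<^sup>2))"
    by (rule PX.integral_abs_le_sqrt[OF _ integrable_dilated_sum_square dilated_sum_bound]) measurable
  then show ?thesis
    using A_nonneg by (simp add: real_sqrt_mult)
qed

lemma f_square_le: "(f x)\<^sup>2 \<le> A\<^sup>2"
  using power_mono[OF abs_f_le abs_ge_zero, of x 2] by simp

lemma integral_abs_ergodic_square:
  assumes "n > 0"
  shows "(\<integral>x. \<bar>(\<Sum>k=1..n. (f (real k * x))\<^sup>2) / n - s2\<bar> \<partial>P_X) \<le> A\<^sup>2 / sqrt n"
    and "integrable P_X (\<lambda>x. \<bar>(\<Sum>k=1..n. (f (real k * x))\<^sup>2) / n - s2\<bar>)"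
proof -
  define g where "g x = (\<Sum>k=1..n. (f (real k * x))\<^sup>2) / n - s2" for x
  have [measurable]: "g \<in> borel_measurable borel"
    unfolding g_def by measurable
  have "\<bar>g x\<bar> \<le> A\<^sup>2 + s2" for x
  proof -
    have "(\<Sum>k=1..n. (f (real k * x))\<^sup>2) \<le> (\<Sum>k=1..n. A\<^sup>2)"
      by (intro sum_mono f_square_le)
    then have "(\<Sum>k=1..n. (f (real k * x))\<^sup>2) / n \<le> A\<^sup>2"
      using assms by (simp add: field_simps)
    moreover have "0 \<le> (\<Sum>k=1..n. (f (real k * x))\<^sup>2) / n"
      by (intro divide_nonneg_nonneg sum_nonneg) auto
    ultimately show ?thesis
      unfolding g_def using s2_nonneg by linarith
  qed
  note bound = this
  have int: "integrable P_X g"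
    using bound by (intro integrable_P_X_bounded[where B = "A\<^sup>2 + s2"]) auto
  have int2: "integrable P_X (\<lambda>x. (g x)\<^sup>2)"
    using power_mono[OF bound abs_ge_zero, of _ 2]
    by (intro integrable_P_X_bounded[where B = "(A\<^sup>2 + s2)\<^sup>2"]) auto
  have "(\<integral>x. \<bar>g x\<bar> \<partial>P_X) \<le> sqrt (A^4 / n)"
    by (rule PX.integral_abs_le_sqrt) (use int2 ergodic_square_bound[OF assms] in \<open>auto simp: g_def\<close>)
  also have "\<dots> = A\<^sup>2 / sqrt n"
    using real_sqrt_abs[of "A\<^sup>2"] by (simp add: real_sqrt_divide)
  finally show "(\<integral>x. \<bar>(\<Sum>k=1..n. (f (real k * x))\<^sup>2) / n - s2\<bar> \<partial>P_X) \<le> A\<^sup>2 / sqrt n"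
    by (simp add: g_def)
  show "integrable P_X (\<lambda>x. \<bar>(\<Sum>k=1..n. (f (real k * x))\<^sup>2) / n - s2\<bar>)"
    using integrable_abs[OF int] by (simp add: g_def)
qed

text \<open>For frozen x this is a dilated sum in y with coefficients f(kx)/n, whose squares add up
  to at most A^2/n. The bound therefore holds for every x, with no averaging in x.\<close>

lemma integral_abs_correlation:
  assumes "n > 0"
  shows "(\<integral>y. \<bar>(\<Sum>k=1..n. f (real k * x) * f (real k * y)) / n\<bar> \<partial>P_X) \<le> A\<^sup>2 / sqrt n"
    and "integrable P_X (\<lambda>y. \<bar>(\<Sum>k=1..n. f (real k * x) * f (real k * y)) / n\<bar>)"
proof -
  define b where "b k = f (real k * x) / n" for k
  have eq: "(\<Sum>k=1..n. f (real k * x) * f (real k * y)) / n = (\<Sum>k=1..n. b k * f (real k * y))" for y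
    by (simp add: b_def sum_divide_distrib)
  have "(\<Sum>k=1..n. (b k)\<^sup>2) \<le> (\<Sum>k=1..n. A\<^sup>2 / (real n)\<^sup>2)"
    unfolding b_def power_divide by (intro sum_mono divide_right_mono f_square_le) auto
  also have "\<dots> = A\<^sup>2 / n"
    using assms by (simp add: power2_eq_square)
  finally have "sqrt (\<Sum>k=1..n. (b k)\<^sup>2) \<le> A / sqrt n"
    using A_nonneg by (metis real_sqrt_abs real_sqrt_divide real_sqrt_le_iff abs_of_nonneg)
  from mult_left_mono[OF this A_nonneg]
  show "(\<integral>y. \<bar>(\<Sum>k=1..n. f (real k * x) * f (real k * y)) / n\<bar> \<partial>P_X) \<le> A\<^sup>2 / sqrt n"
    unfolding eq using integral_abs_dilated_sum[of b "{1..n}"] by (simp add: power2_eq_square)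
  show "integrable P_X (\<lambda>y. \<bar>(\<Sum>k=1..n. f (real k * x) * f (real k * y)) / n\<bar>)"
    unfolding eq
    by (rule integrable_P_X_bounded[where B = "\<Sum>k=1..n. \<bar>b k\<bar> * A"])
       (auto simp del: One_nat_def intro!: abs_sum_f_le)
qed

end

section \<open>Mean square distance from the Gaussian characteristic function\<close>

context random_wiener_sum
begin

definition \<Psi> :: "nat \<Rightarrow> real \<Rightarrow> 'w \<Rightarrow> complex" where
  "\<Psi> n t \<omega> = (\<integral>x. cis (t * random_sum f a n \<omega> x) \<partial>P_X)"

definition gauss :: "real \<Rightarrow> real" where
  "gauss t = exp (- (t\<^sup>2 / 2) * s2)"

lemma gauss_le_1: "0 \<le> gauss t" "gauss t \<le> 1"
  using s2_nonneg by (auto simp: gauss_def)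

lemma random_sum_measurable_pair [measurable]:
  "(\<lambda>p. random_sum f a n (fst p) (snd p)) \<in> borel_measurable (M \<Otimes>\<^sub>M P_X)"
  unfolding random_sum_def
  by (intro borel_measurable_times borel_measurable_const borel_measurable_sum
      measurable_compose[OF measurable_fst a_measurable] measurable_compose[OF _ f_measurable]
      measurable_compose[OF measurable_snd]) auto

lemma random_sum_measurable [measurable]: "random_sum f a n \<omega> \<in> borel_measurable borel"
  unfolding random_sum_def by measurable

lemma \<Psi>_measurable [measurable]: "\<Psi> n t \<in> borel_measurable M"
  unfolding \<Psi>_def by measurable

text \<open>The first bracket is the two-point error with weights bounded by 2A. In the factor 4,
  the ergodic averages at x and y count once each and the correlation twice. The last bracket is the
  one-point error, doubled by the cross terms of \<open>second_moment_fubini\<close>.\<close>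

definition rate :: "real \<Rightarrow> real" where
  "rate T = (\<rho> * (T * (2 * A)) ^ 3 + (T * (2 * A)) ^ 4) + 4 * T\<^sup>2 * A\<^sup>2
    + 2 * ((\<rho> * (T * A) ^ 3 + (T * A) ^ 4) + T\<^sup>2 * A\<^sup>2)"

text \<open>Taking the expectation over the coefficients with x and y frozen reduces everything to
  \<open>clt_error\<close>; what is left to integrate over x and y is the deviation of the mean
  squares and the correlation, each O(n^(-1/2)) in L1.\<close>

lemma second_moment_bound:
  assumes "n > 0" and t: "\<bar>t\<bar> \<le> T"
  shows "expectation (\<lambda>\<omega>. (cmod (\<Psi> n t \<omega> - gauss t))\<^sup>2) \<le> rate T / sqrt n"
proof -
  define Z where "Z \<omega> x = cis (t * random_sum f a n \<omega> x)" for \<omega> x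
  define h where "h K = \<rho> * (T * K) ^ 3 + (T * K) ^ 4" for K
  define v where "v x = \<bar>(\<Sum>k=1..n. (f (real k * x))\<^sup>2) / n - s2\<bar>" for x
  define r where "r x y = \<bar>(\<Sum>k=1..n. f (real k * x) * f (real k * y)) / n\<bar>" for x y
  have T: "T \<ge> 0" using t by simp
  have h: "h K \<ge> 0" if "K \<ge> 0" for K
    using that T \<rho>_nonneg by (simp add: h_def)
  have v: "(\<integral>x. v x \<partial>P_X) \<le> A\<^sup>2 / sqrt n" "integrable P_X v"
    using integral_abs_ergodic_square[OF \<open>n > 0\<close>] by (simp_all add: v_def[abs_def])
  have r: "(\<integral>y. r x y \<partial>P_X) \<le> A\<^sup>2 / sqrt n" "integrable P_X (r x)" for x
    using integral_abs_correlation[OF \<open>n > 0\<close>, of x] by (simp_all add: r_def[abs_def])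
  have v0: "v x \<ge> 0" and r0: "r x y \<ge> 0" for x y
    by (simp_all add: v_def r_def)
  have g2: "complex_of_real ((gauss t)\<^sup>2) = complex_of_real (exp (- (t\<^sup>2 / 2) * (2 * s2)))"
    unfolding gauss_def by (simp add: power2_eq_square flip: exp_add)
  have one: "cmod (expectation (\<lambda>\<omega>. Z \<omega> x) - gauss t) \<le> h A / sqrt n + T\<^sup>2 * v x" for x
    using clt_error[OF \<open>n > 0\<close> abs_f_le t s2_nonneg, of "\<lambda>k. real k * x"]
    by (simp add: Z_def random_sum_def gauss_def h_def v_def)
  have two: "cmod (expectation (\<lambda>\<omega>. Z \<omega> x * cnj (Z \<omega> y)) - complex_of_real ((gauss t)\<^sup>2))
      \<le> h (2 * A) / sqrt n + T\<^sup>2 * (v x + v y + 2 * r x y)" for x y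
  proof -
    define w where "w k = f (real k * x) - f (real k * y)" for k
    have w: "\<bar>w k\<bar> \<le> 2 * A" for k
      using abs_f_le[of "real k * x"] abs_f_le[of "real k * y"] unfolding w_def by linarith
    have "Z \<omega> x * cnj (Z \<omega> y) = cis (t * (1 / sqrt n * (\<Sum>k=1..n. a k \<omega> * w k)))" for \<omega>
      by (simp add: Z_def random_sum_def w_def cis_cnj cis_mult sum_subtractf right_diff_distrib diff_divide_distrib)
    then have "cmod (expectation (\<lambda>\<omega>. Z \<omega> x * cnj (Z \<omega> y)) - complex_of_real ((gauss t)\<^sup>2))
        \<le> h (2 * A) / sqrt n + T\<^sup>2 * \<bar>(\<Sum>k=1..n. (w k)\<^sup>2) / n - 2 * s2\<bar>"
      using clt_error[OF \<open>n > 0\<close> w t, of "2 * s2"] s2_nonneg unfolding g2 by (simp add: h_def)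
    \<comment> \<open>Expanding the square of f(kx) - f(ky) splits the deviation into two ergodic
      averages and one correlation.\<close>
    also have "(\<Sum>k=1..n. (w k)\<^sup>2) / n - 2 * s2 = ((\<Sum>k=1..n. (f (real k * x))\<^sup>2) / n - s2)
        + ((\<Sum>k=1..n. (f (real k * y))\<^sup>2) / n - s2) - 2 * ((\<Sum>k=1..n. f (real k * x) * f (real k * y)) / n)"
      by (simp add: w_def power2_diff sum.distrib sum_subtractf add_divide_distrib diff_divide_distrib
          mult.assoc flip: sum_distrib_left)
    also have "\<bar>\<dots>\<bar> \<le> v x + v y + 2 * r x y"
      unfolding v_def r_def by linarith
    finally show ?thesis
      by (simp add: mult_left_mono)
  qed
  have inner: "(\<integral>y. cmod (expectation (\<lambda>\<omega>. Z \<omega> x * cnj (Z \<omega> y)) - complex_of_real ((gauss t)\<^sup>2)) \<partial>P_X)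
      \<le> (h (2 * A) + 3 * T\<^sup>2 * A\<^sup>2) / sqrt n + T\<^sup>2 * v x" for x
  proof -
    have "(\<integral>y. cmod (expectation (\<lambda>\<omega>. Z \<omega> x * cnj (Z \<omega> y)) - complex_of_real ((gauss t)\<^sup>2)) \<partial>P_X)
        \<le> (\<integral>y. h (2 * A) / sqrt n + T\<^sup>2 * (v x + v y + 2 * r x y) \<partial>P_X)"
      by (rule integral_mono') (use two v r h v0 r0 A_nonneg in \<open>auto intro!: add_nonneg_nonneg mult_nonneg_nonneg\<close>)
    also have "\<dots> = h (2 * A) / sqrt n + T\<^sup>2 * (v x + (\<integral>y. v y \<partial>P_X) + 2 * (\<integral>y. r x y \<partial>P_X))"
      using v r by (simp add: PX.prob_space[simplified])
    also have "\<dots> \<le> h (2 * A) / sqrt n + T\<^sup>2 * (v x + A\<^sup>2 / sqrt n + 2 * (A\<^sup>2 / sqrt n))"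
      using v r by (intro add_mono mult_left_mono order_refl) auto
    finally show ?thesis
      by (simp add: algebra_simps add_divide_distrib)
  qed
  have "(\<integral>x. (\<integral>y. cmod (expectation (\<lambda>\<omega>. Z \<omega> x * cnj (Z \<omega> y)) - complex_of_real ((gauss t)\<^sup>2)) \<partial>P_X) \<partial>P_X)
      \<le> (\<integral>x. (h (2 * A) + 3 * T\<^sup>2 * A\<^sup>2) / sqrt n + T\<^sup>2 * v x \<partial>P_X)"
    by (rule integral_mono') (use inner v h v0 A_nonneg in \<open>auto intro!: add_nonneg_nonneg mult_nonneg_nonneg divide_nonneg_nonneg\<close>)
  also have "\<dots> = (h (2 * A) + 3 * T\<^sup>2 * A\<^sup>2) / sqrt n + T\<^sup>2 * (\<integral>x. v x \<partial>P_X)"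
    using v by (simp add: PX.prob_space[simplified])
  also have "\<dots> \<le> (h (2 * A) + 3 * T\<^sup>2 * A\<^sup>2) / sqrt n + T\<^sup>2 * (A\<^sup>2 / sqrt n)"
    using v by (intro add_mono mult_left_mono order_refl) auto
  also have "\<dots> = (h (2 * A) + 4 * T\<^sup>2 * A\<^sup>2) / sqrt n"
    by (simp add: add_divide_distrib)
  finally have part2: "(\<integral>x. (\<integral>y. cmod (expectation (\<lambda>\<omega>. Z \<omega> x * cnj (Z \<omega> y)) - complex_of_real ((gauss t)\<^sup>2)) \<partial>P_X) \<partial>P_X)
      \<le> (h (2 * A) + 4 * T\<^sup>2 * A\<^sup>2) / sqrt n" .
  have "(\<integral>x. cmod (expectation (\<lambda>\<omega>. Z \<omega> x) - gauss t) \<partial>P_X) \<le> (\<integral>x. h A / sqrt n + T\<^sup>2 * v x \<partial>P_X)"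
    by (rule integral_mono') (use one v h v0 A_nonneg in \<open>auto intro!: add_nonneg_nonneg mult_nonneg_nonneg\<close>)
  also have "\<dots> = h A / sqrt n + T\<^sup>2 * (\<integral>x. v x \<partial>P_X)"
    using v by (simp add: PX.prob_space[simplified])
  also have "\<dots> \<le> h A / sqrt n + T\<^sup>2 * (A\<^sup>2 / sqrt n)"
    using v by (intro add_mono mult_left_mono order_refl) auto
  finally have "2 * \<bar>gauss t\<bar> * (\<integral>x. cmod (expectation (\<lambda>\<omega>. Z \<omega> x) - gauss t) \<partial>P_X)
      \<le> 2 * 1 * ((h A + T\<^sup>2 * A\<^sup>2) / sqrt n)"
    using gauss_le_1 by (intro mult_mono) (auto simp: add_divide_distrib)
  moreover have "expectation (\<lambda>\<omega>. (cmod ((\<integral>x. Z \<omega> x \<partial>P_X) - gauss t))\<^sup>2) \<le>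
     (\<integral>x. (\<integral>y. cmod (expectation (\<lambda>\<omega>. Z \<omega> x * cnj (Z \<omega> y)) - complex_of_real ((gauss t)\<^sup>2)) \<partial>P_X) \<partial>P_X)
       + 2 * \<bar>gauss t\<bar> * (\<integral>x. cmod (expectation (\<lambda>\<omega>. Z \<omega> x) - gauss t) \<partial>P_X)"
    using MX.second_moment_fubini[of Z "gauss t"] by (simp add: Z_def case_prod_beta')
  ultimately have "expectation (\<lambda>\<omega>. (cmod ((\<integral>x. Z \<omega> x \<partial>P_X) - gauss t))\<^sup>2)
      \<le> (h (2 * A) + 4 * T\<^sup>2 * A\<^sup>2) / sqrt n + 2 * 1 * ((h A + T\<^sup>2 * A\<^sup>2) / sqrt n)"
    using part2 by linarith
  then show ?thesis
    by (simp add: \<Psi>_def Z_def rate_def h_def add_divide_distrib)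
qed

end

section \<open>Almost sure convergence\<close>

text \<open>The series of the X j has finite expectation, so it converges almost surely and its
  terms tend to 0. All almost sure statements below come from this.\<close>

lemma (in prob_space) AE_tendsto_zero_summable:
  fixes X :: "nat \<Rightarrow> 'a \<Rightarrow> real"
  assumes int: "\<And>j. integrable M (X j)" and nonneg: "\<And>j \<omega>. X j \<omega> \<ge> 0"
    and le: "\<And>j. expectation (X j) \<le> u j" and u: "summable u"
  shows "AE \<omega> in M. (\<lambda>j. X j \<omega>) \<longlonglongrightarrow> 0"
proof -
  have [measurable]: "X j \<in> borel_measurable M" for j
    using int by auto
  have u0: "u j \<ge> 0" for j
    using le[of j] Bochner_Integration.integral_nonneg[of M "X j"] nonneg by (meson order.trans)
  have "(\<integral>\<^sup>+\<omega>. (\<Sum>j. ennreal (X j \<omega>)) \<partial>M) = (\<Sum>j. \<integral>\<^sup>+\<omega>. ennreal (X j \<omega>) \<partial>M)"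
    by (rule nn_integral_suminf) measurable
  also have "\<dots> \<le> (\<Sum>j. ennreal (u j))"
    using le by (intro suminf_le) (auto simp: nn_integral_eq_integral[OF int] nonneg intro!: ennreal_leI)
  also have "\<dots> = ennreal (suminf u)"
    by (rule suminf_ennreal2[OF u0 u])
  also have "\<dots> < \<infinity>"
    by simp
  finally have "AE \<omega> in M. (\<Sum>j. ennreal (X j \<omega>)) \<noteq> \<infinity>"
    by (intro nn_integral_PInf_AE) auto
  then show ?thesis
  proof eventually_elim
    case (elim \<omega>)
    then have "summable (\<lambda>j. X j \<omega>)"
      by (intro summable_suminf_not_top) (auto simp: nonneg)
    then show ?case
      by (rule summable_LIMSEQ_zero)
  qed
qed

section \<open>Passing from the subsequence of powers to all n\<close>

lemma norm_cis_diff_le: "cmod (cis a - cis b) \<le> \<bar>a - b\<bar>"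
proof -
  have "cmod (cis (a - b) - 1) \<le> \<bar>a - b\<bar>"
    using iexp_approx1[of "a - b" 0] by (simp add: cis_conv_exp)
  moreover have "cis a - cis b = cis b * (cis (a - b) - 1)"
    by (simp add: algebra_simps cis_mult)
  ultimately show ?thesis
    by (simp add: norm_mult)
qed

lemma LIMSEQ_power_blocks:
  fixes x :: "nat \<Rightarrow> 'a::metric_space"
  assumes "p > 0" and err: "err \<longlonglongrightarrow> 0"
    and le: "\<And>j n. j \<ge> 1 \<Longrightarrow> j ^ p \<le> n \<Longrightarrow> n \<le> (j + 1) ^ p \<Longrightarrow> dist (x n) L \<le> err j"
  shows "x \<longlonglongrightarrow> L"
proof (rule metric_LIMSEQ_I)
  fix e :: real
  assume "e > 0"
  then obtain J where J: "\<And>j. j \<ge> J \<Longrightarrow> \<bar>err j\<bar> < e"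
    using LIMSEQ_D[OF err, of e] by auto
  show "\<exists>N. \<forall>n\<ge>N. dist (x n) L < e"
  \<comment> \<open>With \<open>Suc J\<close> in place of J, the block index i found below is at
    least 1, as the block estimate requires.\<close>
  proof (intro exI[of _ "(Suc J) ^ p"] allI impI)
    fix n
    assume n: "n \<ge> Suc J ^ p"
    define j where "j = (LEAST j. n < j ^ p)"
    have "n < (Suc n) ^ p"
      using self_le_power[of "Suc n" p] \<open>p > 0\<close> by simp
    then have j: "n < j ^ p"
      unfolding j_def by (rule LeastI)
    then obtain i where i: "j = Suc i"
      using \<open>p > 0\<close> by (cases j) (auto simp: zero_power)
    have "\<not> n < i ^ p"
      using not_less_Least[of i "\<lambda>j. n < j ^ p"] i unfolding j_def[symmetric] by simp
    moreover have "Suc J < j"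
      using n j power_less_imp_less_base[of "Suc J" p j] by simp
    ultimately have "dist (x n) L \<le> err i"
      using j i by (intro le) auto
    moreover have "\<bar>err i\<bar> < e"
      using \<open>Suc J < j\<close> i by (intro J) auto
    ultimately show "dist (x n) L < e"
      by linarith
  qed
qed

text \<open>255 = 2^8 - 1 is the sum of the nonconstant binomial coefficients; every power of y =
  1/j is bounded by y.\<close>

lemma power_8_block_le:
  assumes "j \<ge> 1"
  shows "(real ((j + 1) ^ 8) - real (j ^ 8)) / real (j ^ 8) \<le> 255 / real j"
proof -
  define y where "y = 1 / real j"
  have y: "0 \<le> y" "y \<le> 1"
    using assms by (auto simp: y_def)
  have "(real ((j + 1) ^ 8) - real (j ^ 8)) / real (j ^ 8) = (1 + y) ^ 8 - 1"
  proof -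
    have "1 + y = real (j + 1) / real j"
      using assms by (simp add: y_def field_simps)
    then show ?thesis
      using assms by (simp add: power_divide diff_divide_distrib)
  qed
  also have "(1 + y) ^ 8 \<le> 1 + 255 * y"
  proof -
    have le: "y ^ k \<le> y" if "k \<ge> 1" for k
      using power_decreasing[OF that y] by simp
    have "(1 + y) ^ 8 = 1 + 8 * y + 28 * y ^ 2 + 56 * y ^ 3 + 70 * y ^ 4 + 56 * y ^ 5 + 28 * y ^ 6 + 8 * y ^ 7 + y ^ 8"
      by algebra
    then show ?thesis
      using le[of 2] le[of 3] le[of 4] le[of 5] le[of 6] le[of 7] le[of 8] by simp
  qed
  finally show ?thesis
    by (simp add: y_def)
qed

context wiener_algebra
begin

text \<open>\<open>cis\<close> is 1-Lipschitz, so the L1 bound for dilated sums controls the change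
  of a characteristic function. It serves for changes of t as well as of n.\<close>

lemma integral_cis_diff_le:
  assumes [measurable]: "g \<in> borel_measurable borel" "h \<in> borel_measurable borel"
    and diff: "\<And>x. g x - h x = (\<Sum>k\<in>I. b k * f (real k * x))"
  shows "cmod ((\<integral>x. cis (g x) \<partial>P_X) - (\<integral>x. cis (h x) \<partial>P_X)) \<le> A * sqrt (\<Sum>k\<in>I. (b k)\<^sup>2)"
proof -
  have "(\<integral>x. cis (g x) \<partial>P_X) - (\<integral>x. cis (h x) \<partial>P_X) = (\<integral>x. cis (g x) - cis (h x) \<partial>P_X)"
    by (intro Bochner_Integration.integral_diff[symmetric] integrable_P_X_bounded[where B = 1]) auto
  also have "cmod \<dots> \<le> (\<integral>x. cmod (cis (g x) - cis (h x)) \<partial>P_X)"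
    by (rule integral_norm_bound)
  also have "\<dots> \<le> (\<integral>x. \<bar>\<Sum>k\<in>I. b k * f (real k * x)\<bar> \<partial>P_X)"
  proof (rule integral_mono')
    show "integrable P_X (\<lambda>x. \<bar>\<Sum>k\<in>I. b k * f (real k * x)\<bar>)"
      by (rule integrable_P_X_bounded[where B = "\<Sum>k\<in>I. \<bar>b k\<bar> * A"]) (auto intro!: abs_sum_f_le)
    show "cmod (cis (g x) - cis (h x)) \<le> \<bar>\<Sum>k\<in>I. b k * f (real k * x)\<bar>" for x
      using norm_cis_diff_le[of "g x" "h x"] by (simp add: diff)
  qed simp
  also have "\<dots> \<le> A * sqrt (\<Sum>k\<in>I. (b k)\<^sup>2)"
    by (rule integral_abs_dilated_sum)
  finally show ?thesis .
qed

end

context random_wiener_sum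
begin

definition S2 :: "nat set \<Rightarrow> 'w \<Rightarrow> real" where
  "S2 I \<omega> = (\<Sum>k\<in>I. (a k \<omega>)\<^sup>2)"

lemma S2_nonneg: "S2 I \<omega> \<ge> 0"
  unfolding S2_def by (rule sum_nonneg) simp

lemma \<Psi>_lipschitz: "cmod (\<Psi> n t \<omega> - \<Psi> n s \<omega>) \<le> \<bar>t - s\<bar> * (A * sqrt (S2 {1..n} \<omega> / n))"
proof -
  have "cmod (\<Psi> n t \<omega> - \<Psi> n s \<omega>) \<le> A * sqrt (\<Sum>k=1..n. ((t - s) * (1 / sqrt n) * a k \<omega>)\<^sup>2)"
    unfolding \<Psi>_def
  proof (rule integral_cis_diff_le)
    show "t * random_sum f a n \<omega> x - s * random_sum f a n \<omega> x =
        (\<Sum>k=1..n. (t - s) * (1 / sqrt n) * a k \<omega> * f (real k * x))" for x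
      unfolding random_sum_def sum_distrib_left sum_subtractf[symmetric]
      by (intro sum.cong) (auto simp: algebra_simps diff_divide_distrib)
  qed measurable
  also have "(\<Sum>k=1..n. ((t - s) * (1 / sqrt n) * a k \<omega>)\<^sup>2) = (t - s)\<^sup>2 * (S2 {1..n} \<omega> / n)"
    by (simp add: power_mult_distrib power_divide S2_def sum_distrib_left sum_divide_distrib)
  finally show ?thesis
    unfolding real_sqrt_mult real_sqrt_abs by (simp only: mult.left_commute)
qed

text \<open>Passing from N to n rescales the old terms by the change of 1/sqrt and adds new terms
  with factor 1/sqrt n. The bound mentions only the block ends N and N', so one estimate serves the
  whole block.\<close>

lemma \<Psi>_interpolate:
  assumes "1 \<le> N" "N \<le> n" "n \<le> N'"
  shows "cmod (\<Psi> n t \<omega> - \<Psi> N t \<omega>) \<le>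
    \<bar>t\<bar> * (A * sqrt (((real N' - real N) / real N)\<^sup>2 * (S2 {1..N} \<omega> / N) + S2 {N<..N'} \<omega> / N))"
proof -
  define b where "b k = t * ((if k \<le> N then 1 / sqrt n - 1 / sqrt N else 1 / sqrt n) * a k \<omega>)" for k
  have split: "{1..n} = {1..N} \<union> {N<..n}" "{1..N} \<inter> {N<..n} = {}"
    using assms by auto
  have "t * random_sum f a n \<omega> x - t * random_sum f a N \<omega> x = (\<Sum>k=1..n. b k * f (real k * x))" for x
  proof -
    have 1: "(\<Sum>k=1..N. b k * f (real k * x)) = t * (1 / sqrt n - 1 / sqrt N) * (\<Sum>k=1..N. a k \<omega> * f (real k * x))"
      unfolding sum_distrib_left by (intro sum.cong) (auto simp: b_def mult_ac)
    have 2: "(\<Sum>k\<in>{N<..n}. b k * f (real k * x)) = t * (1 / sqrt n) * (\<Sum>k\<in>{N<..n}. a k \<omega> * f (real k * x))"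
      unfolding sum_distrib_left by (intro sum.cong) (auto simp: b_def mult_ac)
    have "random_sum f a n \<omega> x = 1 / sqrt n * ((\<Sum>k=1..N. a k \<omega> * f (real k * x)) + (\<Sum>k\<in>{N<..n}. a k \<omega> * f (real k * x)))"
      unfolding random_sum_def split(1) by (subst sum.union_disjoint) (use split(2) in auto)
    moreover have "(\<Sum>k=1..n. b k * f (real k * x)) = (\<Sum>k=1..N. b k * f (real k * x)) + (\<Sum>k\<in>{N<..n}. b k * f (real k * x))"
      unfolding split(1) by (subst sum.union_disjoint) (use split(2) in auto)
    ultimately show ?thesis
      unfolding 1 2 random_sum_def by (simp add: algebra_simps)
  qed
  then have "cmod (\<Psi> n t \<omega> - \<Psi> N t \<omega>) \<le> A * sqrt (\<Sum>k=1..n. (b k)\<^sup>2)"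
    unfolding \<Psi>_def by (intro integral_cis_diff_le) auto
  also have "\<dots> \<le> A * sqrt (t\<^sup>2 * (((real N' - real N) / real N)\<^sup>2 * (S2 {1..N} \<omega> / N) + S2 {N<..N'} \<omega> / N))"
  proof (intro mult_left_mono real_sqrt_le_mono A_nonneg)
    have "(\<Sum>k=1..n. (b k)\<^sup>2) = (\<Sum>k=1..N. (b k)\<^sup>2) + (\<Sum>k\<in>{N<..n}. (b k)\<^sup>2)"
      unfolding split(1) by (subst sum.union_disjoint) (use split(2) in auto)
    also have "(\<Sum>k=1..N. (b k)\<^sup>2) = t\<^sup>2 * ((1 / sqrt n - 1 / sqrt N)\<^sup>2 * S2 {1..N} \<omega>)"
      unfolding S2_def sum_distrib_left by (intro sum.cong) (auto simp: b_def power_mult_distrib)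
    also have "(\<Sum>k\<in>{N<..n}. (b k)\<^sup>2) = t\<^sup>2 * (1 / n * S2 {N<..n} \<omega>)"
      unfolding S2_def sum_distrib_left by (intro sum.cong) (auto simp: b_def power_mult_distrib power_divide)
    finally have eq: "(\<Sum>k=1..n. (b k)\<^sup>2) = t\<^sup>2 * ((1 / sqrt n - 1 / sqrt N)\<^sup>2 * S2 {1..N} \<omega> + 1 / n * S2 {N<..n} \<omega>)"
      by (simp add: distrib_left)
    \<comment> \<open>Since N/n <= 1, its square root is at least N/n. Hence 1 - sqrt(N/n) <= (n -
      N)/n, at most the relative block length.\<close>
    have "(1 / sqrt n - 1 / sqrt N)\<^sup>2 \<le> ((real N' - real N) / real N)\<^sup>2 * (1 / N)"
    proof -
      have Nn: "0 < real N" "real N \<le> real n" "real n \<le> real N'"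
        using assms by auto
      have "real N / n \<le> sqrt (real N / n)"
      proof (rule real_le_rsqrt)
        have "real N / n * (real N / n) \<le> real N / n * 1"
          using Nn by (intro mult_left_mono) auto
        then show "(real N / n)\<^sup>2 \<le> real N / n"
          by (simp add: power2_eq_square)
      qed
      moreover have "sqrt (real N / n) \<le> 1"
        using Nn by simp
      ultimately have "\<bar>1 - sqrt (real N / n)\<bar> \<le> 1 - real N / n"
        by simp
      also have "\<dots> = (real n - real N) / n"
        using Nn by (simp add: diff_divide_distrib)
      also have "\<dots> \<le> (real N' - real N) / real N"
        using Nn by (intro frac_le) auto
      finally have "\<bar>1 - sqrt (real N / n)\<bar>\<^sup>2 \<le> ((real N' - real N) / real N)\<^sup>2"
        by (intro power_mono) auto
      then have "(1 - sqrt (real N / n))\<^sup>2 * (1 / N) \<le> ((real N' - real N) / real N)\<^sup>2 * (1 / N)"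
        by (intro mult_right_mono) auto
      moreover have "1 / sqrt n - 1 / sqrt N = - ((1 - sqrt (real N / n)) * (1 / sqrt N))"
        using Nn by (simp add: real_sqrt_divide field_simps)
      then have "(1 / sqrt n - 1 / sqrt N)\<^sup>2 = (1 - sqrt (real N / n))\<^sup>2 * (1 / N)"
        by (simp add: power_mult_distrib power_divide)
      ultimately show ?thesis by simp
    qed
    then have "(1 / sqrt n - 1 / sqrt N)\<^sup>2 * S2 {1..N} \<omega> \<le> ((real N' - real N) / real N)\<^sup>2 * (1 / N) * S2 {1..N} \<omega>"
      by (intro mult_right_mono S2_nonneg)
    moreover have "1 / n * S2 {N<..n} \<omega> \<le> 1 / N * S2 {N<..N'} \<omega>"
      using assms unfolding S2_def by (intro mult_mono frac_le sum_mono2 sum_nonneg) auto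
    ultimately show "(\<Sum>k=1..n. (b k)\<^sup>2) \<le>
        t\<^sup>2 * (((real N' - real N) / real N)\<^sup>2 * (S2 {1..N} \<omega> / N) + S2 {N<..N'} \<omega> / N)"
      unfolding eq by (intro mult_left_mono) auto
  qed
  finally show ?thesis
    unfolding real_sqrt_mult[of "t\<^sup>2"] real_sqrt_abs by (simp only: mult.left_commute)
qed

lemma integrable_S2: "I \<subseteq> {1..} \<Longrightarrow> integrable M (S2 I)"
  unfolding S2_def by (intro Bochner_Integration.integrable_sum integrable_a_square) auto

lemma expectation_S2: "I \<subseteq> {1..} \<Longrightarrow> expectation (S2 I) = card I"
  unfolding S2_def
  by (subst Bochner_Integration.integral_sum)
     (auto simp: integrable_a_square a_second_moment subset_eq intro!: sum.cong[THEN trans])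

definition S3 :: "nat set \<Rightarrow> 'w \<Rightarrow> real" where
  "S3 I \<omega> = (\<Sum>k\<in>I. \<bar>a k \<omega>\<bar> ^ 3)"

lemma S3_nonneg: "S3 I \<omega> \<ge> 0"
  unfolding S3_def by (rule sum_nonneg) simp

lemma integrable_S3: "I \<subseteq> {1..} \<Longrightarrow> integrable M (S3 I)"
  unfolding S3_def by (intro Bochner_Integration.integrable_sum third_moment) auto

lemma expectation_S3: "I \<subseteq> {1..} \<Longrightarrow> expectation (S3 I) = card I * \<rho>"
  unfolding S3_def
  by (subst Bochner_Integration.integral_sum)
     (auto simp: third_moment a_third_moment subset_eq intro!: sum.cong[THEN trans])

text \<open>The sums of \<open>a\<^sup>2\<close> over the blocks have expectation of order \<open>1/j\<close> relative to \<open>j\<^sup>8\<close>, which is not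
  summable; trading them for sums of \<open>\<bar>a\<bar>\<^sup>3\<close> with \<open>l = j\<^bsup>1/4\<^esup>\<close> gains the missing power.\<close>

lemma S2_le_S3:
  fixes l :: real
  assumes "l > 0"
  shows "S2 I \<omega> \<le> S3 I \<omega> / l + card I * l\<^sup>2"
proof -
  have *: "x\<^sup>2 \<le> \<bar>x\<bar> ^ 3 / l + l\<^sup>2" for x :: real
  proof (cases "\<bar>x\<bar> \<le> l")
    case True
    then have "\<bar>x\<bar>\<^sup>2 \<le> l\<^sup>2"
      by (intro power_mono) auto
    moreover have "0 \<le> \<bar>x\<bar> ^ 3 / l"
      using assms by simp
    ultimately show ?thesis
      unfolding power2_abs by linarith
  next
    case False
    then have "x\<^sup>2 * l \<le> x\<^sup>2 * \<bar>x\<bar>"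
      by (intro mult_left_mono) auto
    also have "\<dots> = \<bar>x\<bar> ^ 3"
      by (metis mult.commute numeral_2_eq_2 numeral_3_eq_3 power2_abs power_Suc)
    finally have "x\<^sup>2 \<le> \<bar>x\<bar> ^ 3 / l"
      using assms by (simp add: field_simps)
    then show ?thesis
      using zero_le_power2[of l] by linarith
  qed
  have "S2 I \<omega> \<le> (\<Sum>k\<in>I. \<bar>a k \<omega>\<bar> ^ 3 / l + l\<^sup>2)"
    unfolding S2_def by (intro sum_mono *)
  then show ?thesis
    by (simp add: S3_def sum.distrib sum_divide_distrib)
qed

text \<open>The average of the squares has expectation 1 for j > 0; the extra factor j^2 makes the
  expectations summable. The resulting o(j^2) suffices against the squared relative block length
  O(j^(-2)) and the net spacing j^(-2).\<close>

lemma AE_S2_subsequence: "AE \<omega> in M. (\<lambda>j. S2 {1..j ^ 8} \<omega> / (real (j ^ 8) * (real j)\<^sup>2)) \<longlonglongrightarrow> 0"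
proof (rule AE_tendsto_zero_summable)
  show "integrable M (\<lambda>\<omega>. S2 {1..j ^ 8} \<omega> / (real (j ^ 8) * (real j)\<^sup>2))" for j
    by (intro integrable_divide integrable_S2) auto
  show "expectation (\<lambda>\<omega>. S2 {1..j ^ 8} \<omega> / (real (j ^ 8) * (real j)\<^sup>2)) \<le> inverse ((real j)\<^sup>2)" for j
    by (cases "j = 0") (simp_all add: expectation_S2 divide_simps)
  show "summable (\<lambda>j. inverse ((real j)\<^sup>2))"
    by (rule inverse_power_summable) simp
qed (simp add: S2_nonneg)

text \<open>A block has relative length at most 255/j, and the extra j^(1/4) yields the summable
  j^(-5/4).\<close>

lemma AE_S3_blocks:
  "AE \<omega> in M. (\<lambda>j. S3 {j ^ 8<..(j + 1) ^ 8} \<omega> / (real j powr (1/4) * real (j ^ 8))) \<longlonglongrightarrow> 0"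
proof (rule AE_tendsto_zero_summable)
  show "integrable M (\<lambda>\<omega>. S3 {j ^ 8<..(j + 1) ^ 8} \<omega> / (real j powr (1/4) * real (j ^ 8)))" for j
    by (intro integrable_divide integrable_S3) auto
  show "expectation (\<lambda>\<omega>. S3 {j ^ 8<..(j + 1) ^ 8} \<omega> / (real j powr (1/4) * real (j ^ 8)))
      \<le> 255 * \<rho> * real j powr (- 5/4)" for j
  proof (cases "j = 0")
    case False
    have "j ^ 8 \<le> (j + 1) ^ 8"
      by (intro power_mono) auto
    then have "real (card {j ^ 8<..(j + 1) ^ 8}) / real (j ^ 8) \<le> 255 / real j"
      using power_8_block_le[of j] False by (simp add: of_nat_diff)
    then have "real (card {j ^ 8<..(j + 1) ^ 8}) / real (j ^ 8) * (\<rho> / real j powr (1/4)) \<le>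
        255 / real j * (\<rho> / real j powr (1/4))"
      by (intro mult_right_mono divide_nonneg_nonneg \<rho>_nonneg) auto
    also have "\<dots> = 255 * \<rho> * real j powr (- 5/4)"
      using False powr_add[of "real j" 1 "1/4"] by (simp add: powr_minus divide_simps)
    finally show ?thesis
      using False by (simp add: expectation_S3 subset_eq mult_ac)
  qed simp
  show "summable (\<lambda>j. 255 * \<rho> * real j powr (- 5/4))"
    by (intro summable_mult) (simp add: summable_real_powr_iff)
qed (auto intro!: divide_nonneg_nonneg mult_nonneg_nonneg S3_nonneg)

lemma norm_\<Psi>_le: "cmod (\<Psi> n t \<omega>) \<le> 1"
  unfolding \<Psi>_def by (rule PX.norm_integral_le) simp

text \<open>There are 2 T j^2 + 1 net points in [-T, T], each with expected squared error at most
  \<open>rate T\<close> / j^4. Summing over the net inside the expectation treats all points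
  simultaneously.\<close>

lemma AE_gauss_net:
  fixes T :: nat
  assumes "T > 0"
  shows "AE \<omega> in M. (\<lambda>j. \<Sum>i\<in>{- int (T * j\<^sup>2)..int (T * j\<^sup>2)}.
    (cmod (\<Psi> (j ^ 8) (of_int i / (real j)\<^sup>2) \<omega> - gauss (of_int i / (real j)\<^sup>2)))\<^sup>2) \<longlonglongrightarrow> 0"
proof -
  have int: "integrable M (\<lambda>\<omega>. (cmod (\<Psi> n t \<omega> - gauss t))\<^sup>2)" for n t
  proof (rule integrable_const_bound[where B = "(1 + 1)\<^sup>2"])
    have "cmod (\<Psi> n t \<omega> - gauss t) \<le> 1 + 1" for \<omega>
      using gauss_le_1 by (intro order.trans[OF norm_triangle_ineq4] add_mono norm_\<Psi>_le) auto
    from power_mono[OF this norm_ge_zero, where n = 2]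
    show "AE \<omega> in M. norm ((cmod (\<Psi> n t \<omega> - gauss t))\<^sup>2) \<le> (1 + 1)\<^sup>2"
      by simp
  qed measurable
  define X where "X j \<omega> = (\<Sum>i\<in>{- int (T * j\<^sup>2)..int (T * j\<^sup>2)}.
    (cmod (\<Psi> (j ^ 8) (of_int i / (real j)\<^sup>2) \<omega> - gauss (of_int i / (real j)\<^sup>2)))\<^sup>2)" for j \<omega>
  define u where "u j = (if j = 0 then expectation (X 0) else 3 * T * rate T * inverse ((real j)\<^sup>2))" for j
  have "AE \<omega> in M. (\<lambda>j. X j \<omega>) \<longlonglongrightarrow> 0"
  proof (rule AE_tendsto_zero_summable)
    show "integrable M (X j)" for j
      unfolding X_def by (intro Bochner_Integration.integrable_sum int)
    show "X j \<omega> \<ge> 0" for j \<omega>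
      unfolding X_def by (intro sum_nonneg) simp
    show "expectation (X j) \<le> u j" for j
    proof (cases "j = 0")
      case False
      have "expectation (X j) \<le> (\<Sum>i\<in>{- int (T * j\<^sup>2)..int (T * j\<^sup>2)}. rate T / sqrt (real (j ^ 8)))"
        unfolding X_def
      proof (subst Bochner_Integration.integral_sum[OF int], intro sum_mono second_moment_bound)
        fix i
        assume i: "i \<in> {- int (T * j\<^sup>2)..int (T * j\<^sup>2)}"
        then have "\<bar>i\<bar> \<le> int (T * j\<^sup>2)"
          by auto
        then have "real_of_int \<bar>i\<bar> \<le> real_of_int (int (T * j\<^sup>2))"
          by (simp only: of_int_le_iff)
        then show "\<bar>real_of_int i / (real j)\<^sup>2\<bar> \<le> real T"
          using False by (simp add: divide_simps)
      qed (use False in auto)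
      also have "\<dots> = (2 * T * (real j)\<^sup>2 + 1) * (rate T / (real j) ^ 4)"
      proof -
        have "sqrt (real (j ^ 8)) = real j ^ 4"
          by (rule real_sqrt_unique) (auto simp flip: power_mult)
        then show ?thesis by simp
      qed
      also have "\<dots> \<le> (3 * T * (real j)\<^sup>2) * (rate T / (real j) ^ 4)"
      proof (rule mult_right_mono)
        have "1 \<le> T * j\<^sup>2"
          using False \<open>T > 0\<close> by (simp add: Suc_le_eq)
        then have "1 \<le> real (T * j\<^sup>2)"
          by linarith
        then show "2 * T * (real j)\<^sup>2 + 1 \<le> 3 * T * (real j)\<^sup>2"
          by simp
        have "rate T \<ge> 0"
          using \<rho>_nonneg A_nonneg by (simp add: rate_def)
        then show "0 \<le> rate T / (real j) ^ 4"
          by simp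
      qed
      also have "\<dots> = u j"
        using False by (simp add: u_def field_simps eval_nat_numeral)
      finally show ?thesis .
    qed (simp add: u_def)
    have "summable (\<lambda>j. 3 * T * rate T * inverse ((real j)\<^sup>2))"
      by (intro summable_mult inverse_power_summable) simp
    then show "summable u"
      by (rule summable_cong[THEN iffD1, rotated])
         (rule eventually_mono[OF eventually_gt_at_top[of 0]], simp add: u_def)
  qed
  then show ?thesis
    by (simp add: X_def)
qed

end

text \<open>Rescaling by \<open>\<sigma>\<close> reduces the claim to the standard normal
  distribution.\<close>

lemma char_normal:
  assumes "\<sigma> > 0"
  shows "char (density lborel (normal_density 0 \<sigma>)) t = complex_of_real (exp (- (t\<^sup>2 / 2) * \<sigma>\<^sup>2))"
proof -
  interpret N: prob_space "density lborel (\<lambda>x. ennreal (normal_density 0 \<sigma> x))"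
    by (rule prob_space_normal_density[OF assms])
  have "distributed (density lborel (normal_density 0 \<sigma>)) lborel (\<lambda>x. x) (normal_density 0 \<sigma>)"
    by (simp add: distributed_def distr_id2)
  then have "distributed (density lborel (normal_density 0 \<sigma>)) lborel (\<lambda>x. (x - 0) / \<sigma>) std_normal_density"
    using N.normal_standard_normal_convert[OF assms, of "\<lambda>x. x" 0] by simp
  then have std: "distr (density lborel (normal_density 0 \<sigma>)) lborel (\<lambda>x. x / \<sigma>) = std_normal_distribution"
    by (simp add: distributed_def)
  have "char (density lborel (normal_density 0 \<sigma>)) t =
      (\<integral>x. iexp ((t * \<sigma>) * (x / \<sigma>)) \<partial>density lborel (normal_density 0 \<sigma>))"
    using assms by (simp add: char_def)
  also have "\<dots> = char std_normal_distribution (t * \<sigma>)"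
    unfolding char_def std[symmetric] by (subst integral_distr) auto
  finally show ?thesis
    by (simp add: char_std_normal_distribution power_mult_distrib)
qed

section \<open>Convergence for all t outside one null set\<close>

context random_wiener_sum
begin

text \<open>A deterministic statement about one outcome. The error is split along n to j^8, t to a
  net point \<open>s j\<close>, \<open>\<Psi>\<close> to \<open>gauss\<close> at that point, and
  back to t; the summands of \<open>err\<close> follow this order.\<close>

lemma \<Psi>_tendsto:
  fixes \<omega> :: 'w
  assumes X1: "(\<lambda>j. S2 {1..j ^ 8} \<omega> / (real (j ^ 8) * (real j)\<^sup>2)) \<longlonglongrightarrow> 0"
    and X2: "(\<lambda>j. S3 {j ^ 8<..(j + 1) ^ 8} \<omega> / (real j powr (1/4) * real (j ^ 8))) \<longlonglongrightarrow> 0"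
    and X3: "\<And>T::nat. T > 0 \<Longrightarrow> (\<lambda>j. \<Sum>i\<in>{- int (T * j\<^sup>2)..int (T * j\<^sup>2)}.
      (cmod (\<Psi> (j ^ 8) (of_int i / (real j)\<^sup>2) \<omega> - gauss (of_int i / (real j)\<^sup>2)))\<^sup>2) \<longlonglongrightarrow> 0"
  shows "(\<lambda>n. \<Psi> n t \<omega>) \<longlonglongrightarrow> complex_of_real (gauss t)"
proof -
  define q :: "nat \<Rightarrow> nat" where "q j = j ^ 8" for j
  define x1 where "x1 j = S2 {1..q j} \<omega> / (real (q j) * (real j)\<^sup>2)" for j
  define x2 where "x2 j = S3 {q j<..q (j + 1)} \<omega> / (real j powr (1/4) * real (q j))" for j
  \<comment> \<open>One more than needed for |t|: rounding t to the net can increase its modulus,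
    and T >= |t| + 1 keeps the net point in range.\<close>
  define T where "T = Suc (nat \<lceil>\<bar>t\<bar>\<rceil>)"
  define x3 where "x3 j = (\<Sum>i\<in>{- int (T * j\<^sup>2)..int (T * j\<^sup>2)}.
      (cmod (\<Psi> (j ^ 8) (of_int i / (real j)\<^sup>2) \<omega> - gauss (of_int i / (real j)\<^sup>2)))\<^sup>2)" for j
  define s where "s j = of_int \<lfloor>t * (real j)\<^sup>2\<rfloor> / (real j)\<^sup>2" for j :: nat
  have x1: "x1 \<longlonglongrightarrow> 0" and x2: "x2 \<longlonglongrightarrow> 0" and x3: "x3 \<longlonglongrightarrow> 0"
    using X1 X2 X3[of T] by (simp_all add: x1_def[abs_def] x2_def[abs_def] x3_def[abs_def] q_def T_def)
  define err where "err j =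
      \<bar>t\<bar> * (A * sqrt (255\<^sup>2 * x1 j + (x2 j + 255 * real j powr (- 1/2)))) + (1 * (A * sqrt (x1 j)) + sqrt (x3 j) + \<bar>gauss (s j) - gauss t\<bar>)" for j
  have s_close: "\<bar>t - s j\<bar> \<le> 1 / (real j)\<^sup>2" if "j \<ge> 1" for j
  proof -
    have "\<bar>t * (real j)\<^sup>2 - of_int \<lfloor>t * (real j)\<^sup>2\<rfloor>\<bar> \<le> 1"
      by linarith
    moreover have "t - s j = (t * (real j)\<^sup>2 - of_int \<lfloor>t * (real j)\<^sup>2\<rfloor>) / (real j)\<^sup>2"
      using that by (simp add: s_def field_simps)
    ultimately show ?thesis
      using that by (simp add: divide_right_mono)
  qed
  have "s \<longlonglongrightarrow> t"
  proof (rule Lim_null_comparison[where g = "\<lambda>j. inverse (real j ^ 2)", THEN LIM_zero_cancel])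
    show "eventually (\<lambda>j. norm (s j - t) \<le> inverse (real j ^ 2)) sequentially"
      by (rule eventually_mono[OF eventually_ge_at_top[of 1]])
         (use s_close in \<open>simp add: inverse_eq_divide abs_minus_commute\<close>)
    show "(\<lambda>j. inverse (real j ^ 2)) \<longlonglongrightarrow> 0"
      by real_asymp
  qed
  then have "(\<lambda>j. gauss (s j)) \<longlonglongrightarrow> gauss t"
    unfolding gauss_def by (intro tendsto_intros) simp_all
  then have g0: "(\<lambda>j. \<bar>gauss (s j) - gauss t\<bar>) \<longlonglongrightarrow> 0"
    by (intro tendsto_rabs_zero LIM_zero)
  have p0: "(\<lambda>j. real j powr (- 1/2)) \<longlonglongrightarrow> 0"
    by real_asymp
  have "err \<longlonglongrightarrow> \<bar>t\<bar> * (A * sqrt (255\<^sup>2 * 0 + (0 + 255 * 0))) + (1 * (A * sqrt 0) + sqrt 0 + 0)"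
    unfolding err_def
    by (intro tendsto_add tendsto_mult tendsto_real_sqrt tendsto_const x1 x2 x3 g0 p0)
  then have err: "err \<longlonglongrightarrow> 0"
    by simp
  show ?thesis
  proof (rule LIMSEQ_power_blocks[where p = 8, OF _ err])
    fix j n :: nat
    assume j: "j \<ge> 1" and n: "j ^ 8 \<le> n" "n \<le> (j + 1) ^ 8"
    have q: "q j \<ge> 1" "q j \<le> n" "n \<le> q (j + 1)" "real (q j) > 0"
      using j n by (auto simp: q_def)
    have x1_eq: "S2 {1..q j} \<omega> / q j = (real j)\<^sup>2 * x1 j"
      using j by (simp add: x1_def)
    have x1_nonneg: "x1 j \<ge> 0"
      unfolding x1_def by (intro divide_nonneg_nonneg S2_nonneg) auto
    have block: "(real (q (j + 1)) - real (q j)) / real (q j) \<le> 255 / real j" "0 \<le> (real (q (j + 1)) - real (q j)) / real (q j)"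
      using power_8_block_le[OF j] q by (auto simp: q_def)
    have first: "((real (q (j + 1)) - real (q j)) / real (q j))\<^sup>2 * (S2 {1..q j} \<omega> / q j) \<le> 255\<^sup>2 * x1 j"
    proof -
      have "((real (q (j + 1)) - real (q j)) / real (q j))\<^sup>2 * (S2 {1..q j} \<omega> / q j) \<le> (255 / real j)\<^sup>2 * ((real j)\<^sup>2 * x1 j)"
        unfolding x1_eq by (intro mult_right_mono power_mono block mult_nonneg_nonneg x1_nonneg) auto
      also have "\<dots> = 255\<^sup>2 * x1 j"
        using j by (simp add: power_divide)
      finally show ?thesis .
    qed
    have second: "S2 {q j<..q (j + 1)} \<omega> / q j \<le> x2 j + 255 * real j powr (- 1/2)"
    proof -
      define l where "l = real j powr (1/4)"
      have l: "l > 0" using j by (simp add: l_def)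
      \<comment> \<open>Truncation at l = j^(1/4) costs l^2 per index of the block, and relative
        length 255/j turns this into 255 j^(-1/2).\<close>
      have "l\<^sup>2 = real j powr (1/2)"
        using j by (simp add: l_def power2_eq_square flip: powr_add)
      then have l2: "255 / real j * l\<^sup>2 = 255 * real j powr (- 1/2)"
        using j powr_add[of "real j" "1/2" "1/2"] by (simp add: powr_minus field_simps)
      have "S2 {q j<..q (j + 1)} \<omega> / q j \<le> (S3 {q j<..q (j + 1)} \<omega> / l + card {q j<..q (j + 1)} * l\<^sup>2) / q j"
        by (intro divide_right_mono S2_le_S3 l) auto
      also have "\<dots> = x2 j + (real (q (j + 1)) - real (q j)) / real (q j) * l\<^sup>2"
        using q by (simp add: x2_def l_def add_divide_distrib of_nat_diff)
      also have "\<dots> \<le> x2 j + 255 / real j * l\<^sup>2"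
        by (intro add_left_mono mult_right_mono block) auto
      finally show ?thesis
        unfolding l2 .
    qed
    have "cmod (\<Psi> n t \<omega> - \<Psi> (q j) t \<omega>) \<le>
        \<bar>t\<bar> * (A * sqrt (((real (q (j + 1)) - real (q j)) / real (q j))\<^sup>2 * (S2 {1..q j} \<omega> / q j) + S2 {q j<..q (j + 1)} \<omega> / q j))"
      by (rule \<Psi>_interpolate[OF q(1-3)])
    also have "\<dots> \<le> \<bar>t\<bar> * (A * sqrt (255\<^sup>2 * x1 j + (x2 j + 255 * real j powr (- 1/2))))"
      by (intro mult_left_mono real_sqrt_le_mono add_mono first second A_nonneg) auto
    finally have 1: "cmod (\<Psi> n t \<omega> - \<Psi> (q j) t \<omega>) \<le>
      \<bar>t\<bar> * (A * sqrt (255\<^sup>2 * x1 j + (x2 j + 255 * real j powr (- 1/2))))" .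
    have "cmod (\<Psi> (q j) t \<omega> - \<Psi> (q j) (s j) \<omega>) \<le> \<bar>t - s j\<bar> * (A * sqrt (S2 {1..q j} \<omega> / q j))"
      by (rule \<Psi>_lipschitz)
    also have "\<dots> \<le> 1 / (real j)\<^sup>2 * (A * sqrt (S2 {1..q j} \<omega> / q j))"
      by (intro mult_right_mono s_close j mult_nonneg_nonneg A_nonneg) (simp add: S2_nonneg)
    \<comment> \<open>The average of squares is j^2 times \<open>x1 j\<close>; its root loses a
      factor j, which the spacing j^(-2) more than compensates.\<close>
    also have "\<dots> = 1 / real j * (A * sqrt (x1 j))"
      unfolding x1_eq using j by (simp add: real_sqrt_mult power2_eq_square)
    also have "\<dots> \<le> 1 * (A * sqrt (x1 j))"
      using j A_nonneg x1_nonneg by (intro mult_right_mono) auto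
    finally have 2: "cmod (\<Psi> (q j) t \<omega> - \<Psi> (q j) (s j) \<omega>) \<le> 1 * (A * sqrt (x1 j))" .
    have 3: "cmod (\<Psi> (q j) (s j) \<omega> - gauss (s j)) \<le> sqrt (x3 j)"
    proof (rule real_le_rsqrt)
      have "\<bar>t\<bar> * (real j)\<^sup>2 + 1 \<le> real T * (real j)\<^sup>2"
      proof -
        have "\<bar>t\<bar> + 1 \<le> real T"
          unfolding T_def by linarith
        then have "(\<bar>t\<bar> + 1) * (real j)\<^sup>2 \<le> real T * (real j)\<^sup>2"
          by (rule mult_right_mono) simp
        moreover have "1 \<le> (real j)\<^sup>2"
          using j by simp
        ultimately show ?thesis
          unfolding distrib_right by linarith
      qed
      moreover have "\<bar>t * (real j)\<^sup>2\<bar> = \<bar>t\<bar> * (real j)\<^sup>2"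
        by (simp add: abs_mult)
      ultimately have "\<bar>real_of_int \<lfloor>t * (real j)\<^sup>2\<rfloor>\<bar> \<le> real T * (real j)\<^sup>2"
        by linarith
      then have "real_of_int \<bar>\<lfloor>t * (real j)\<^sup>2\<rfloor>\<bar> \<le> real_of_int (int (T * j\<^sup>2))"
        by simp
      then have "\<bar>\<lfloor>t * (real j)\<^sup>2\<rfloor>\<bar> \<le> int (T * j\<^sup>2)"
        by (simp only: of_int_le_iff)
      then have "\<lfloor>t * (real j)\<^sup>2\<rfloor> \<in> {- int (T * j\<^sup>2)..int (T * j\<^sup>2)}"
        by auto
      then show "(cmod (\<Psi> (q j) (s j) \<omega> - gauss (s j)))\<^sup>2 \<le> x3 j"
        unfolding x3_def s_def q_def
        by (intro member_le_sum[where f = "\<lambda>i. (cmod (\<Psi> (j ^ 8) (of_int i / (real j)\<^sup>2) \<omega> - gauss (of_int i / (real j)\<^sup>2)))\<^sup>2"])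
           auto
    qed
    have 4: "cmod (complex_of_real (gauss (s j)) - gauss t) = \<bar>gauss (s j) - gauss t\<bar>"
      by (simp flip: of_real_diff)
    have "dist (\<Psi> n t \<omega>) (gauss t) \<le> dist (\<Psi> n t \<omega>) (\<Psi> (q j) t \<omega>) + (dist (\<Psi> (q j) t \<omega>) (\<Psi> (q j) (s j) \<omega>)
        + dist (\<Psi> (q j) (s j) \<omega>) (gauss (s j)) + dist (complex_of_real (gauss (s j))) (gauss t))"
      using dist_triangle[of "\<Psi> n t \<omega>" "complex_of_real (gauss t)" "\<Psi> (q j) t \<omega>"]
        dist_triangle[of "\<Psi> (q j) t \<omega>" "complex_of_real (gauss t)" "\<Psi> (q j) (s j) \<omega>"]
        dist_triangle[of "\<Psi> (q j) (s j) \<omega>" "complex_of_real (gauss t)" "complex_of_real (gauss (s j))"]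
      by linarith
    also have "\<dots> \<le> err j"
      using 1 2 3 4 unfolding err_def dist_norm by linarith
    finally show "dist (\<Psi> n t \<omega>) (complex_of_real (gauss t)) \<le> err j" .
  qed simp
qed

text \<open>Only the natural number T indexes the exceptional sets, so their union is null; t is
  quantified after the outcome has been fixed.\<close>

lemma AE_\<Psi>_tendsto: "AE \<omega> in M. \<forall>t. (\<lambda>n. \<Psi> n t \<omega>) \<longlonglongrightarrow> complex_of_real (gauss t)"
proof -
  have "AE \<omega> in M. \<forall>T. T > 0 \<longrightarrow> (\<lambda>j. \<Sum>i\<in>{- int (T * j\<^sup>2)..int (T * j\<^sup>2)}.
      (cmod (\<Psi> (j ^ 8) (of_int i / (real j)\<^sup>2) \<omega> - gauss (of_int i / (real j)\<^sup>2)))\<^sup>2) \<longlonglongrightarrow> 0"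
    unfolding AE_all_countable using AE_gauss_net by auto
  with AE_S2_subsequence AE_S3_blocks show ?thesis
    by eventually_elim (blast intro: \<Psi>_tendsto)
qed

end

theorem theorem2:
  fixes f f' :: "real \<Rightarrow> real"
    and M :: "'w measure"
    and a :: "nat \<Rightarrow> 'w \<Rightarrow> real"
  assumes f_cont: "continuous_on UNIV f"
    and f_periodic: "periodic2pi f"
    and f_H1: "H1_with_derivative f f'"
    and f_pos: "inner2pi f f > 0"
    and f'_pos: "inner2pi f' f' > 0"
    and f_mean: "(LBINT x:{0..2*pi}. f x) = 0"
    and prob: "prob_space M"
    and indep: "prob_space.indep_vars M (\<lambda>_. borel) a {1..}"
    and ident: "\<And>k. k \<ge> 1 \<Longrightarrow> distr M borel (a k) = distr M borel (a 1)"
    and centered: "\<And>k. k \<ge> 1 \<Longrightarrow> prob_space.expectation M (a k) = 0"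
    and variance: "\<And>k. k \<ge> 1 \<Longrightarrow> prob_space.variance M (a k) = 1"
    and third_moment: "\<And>k. k \<ge> 1 \<Longrightarrow> integrable M (\<lambda>\<omega>. \<bar>a k \<omega>\<bar> ^ 3)"
  shows "AE \<omega> in M.
           (\<forall>t::real.
              (\<lambda>n. E_X (\<lambda>z. exp (\<i> * complex_of_real (t * random_sum f a n (fst z) (snd z)))) \<omega>)
                \<longlonglongrightarrow> complex_of_real (exp (- (t\<^sup>2 / 2) * inner2pi f f)))
         \<and> weak_conv_m
              (\<lambda>n. distr P_X borel (\<lambda>x. random_sum f a n \<omega> x))
              (density lborel (normal_density 0 (sqrt (inner2pi f f))))"
proof -
  obtain c A where "wiener_algebra f c A"
    using continuous_H1_wiener_algebra[OF f_cont f_periodic f_H1 f_mean] by blast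
  then interpret random_wiener_sum f c A M a
    by (intro random_wiener_sum.intro random_wiener_sum_axioms.intro
        prob indep ident centered variance third_moment)
  have s2: "s2 = inner2pi f f"
    by (simp add: s2_def inner2pi_eq power2_eq_square)
  have E_X: "E_X (\<lambda>z. exp (\<i> * complex_of_real (t * random_sum f a n (fst z) (snd z)))) \<omega> = \<Psi> n t \<omega>" for t n \<omega>
    by (simp add: E_X_def \<Psi>_def cis_conv_exp)
  have char: "char (distr P_X borel (\<lambda>x. random_sum f a n \<omega> x)) t = \<Psi> n t \<omega>" for t n \<omega>
    unfolding char_def \<Psi>_def by (subst integral_distr) (auto simp: cis_conv_exp)
  show ?thesis
    using AE_\<Psi>_tendsto
  proof eventually_elim
    case (elim \<omega>)
    have "weak_conv_m (\<lambda>n. distr P_X borel (\<lambda>x. random_sum f a n \<omega> x))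
        (density lborel (normal_density 0 (sqrt (inner2pi f f))))"
    \<comment> \<open>For a fixed outcome, \<open>\<Psi>\<close> is the characteristic function of
      the law of f_n(X) under \<open>P_X\<close>. Positivity of <f,f> makes the limiting normal
      density nondegenerate.\<close>
    proof (rule levy_continuity)
      show "real_distribution (distr P_X borel (\<lambda>x. random_sum f a n \<omega> x))" for n
        by (rule PX.real_distribution_distr) simp
      show "real_distribution (density lborel (normal_density 0 (sqrt (inner2pi f f))))"
        using prob_space_normal_density[of "sqrt (inner2pi f f)" 0] f_pos
        by (simp add: real_distribution_def real_distribution_axioms_def)
      show "(\<lambda>n. char (distr P_X borel (\<lambda>x. random_sum f a n \<omega> x)) t)
          \<longlonglongrightarrow> char (density lborel (normal_density 0 (sqrt (inner2pi f f)))) t" for t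
        using elim f_pos by (simp add: char char_normal gauss_def s2)
    qed
    then show ?case
      using elim unfolding E_X by (simp add: gauss_def s2)
  qed
qed

end
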